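(* Let $M$ be a maximal subalgebra of a finite-dimensional Lie algebra $L$ over a field $F$. Then: (i) $M$ is a c-ideal of $L$ if and only if $\mathrm{Sec}(M) = 0$; and (ii) $\eta^*(L:M) = \eta(L:M) - \dim(L/M)$.
   Context: A chief factor of $L$ is a quotient $C/D$ where $D \subsetneq C$ are ideals of $L$ and $C/D$ is a minimal ideal of $L/D$. If $B$ is a subalgebra of $L$, the core $B_L$ is the largest ideal of $L$ contained in $B$. A subalgebra $B$ of $L$ is a c-ideal of $L$ if there is an ideal $C$ of $L$ such that $L = B + C$ and $B \cap C \subseteq B_L$. Let $M$ be a maximal subalgebra of $L$. If $C/D$ is a chief factor of $L$ with $D \subseteq M$ and $L = M + C$, then $(M\cap C)/D$ is called a c-section of $M$ in $L$. All c-sections of $M$ are isomorphic; $\mathrm{Sec}(M)$ denotes the Lie algebra isomorphic to any c-section of $M$, and the c-index of $M$ in $L$ is $\eta^*(L:M) = \dim \mathrm{Sec}(M)$. The ideal index $\eta(L:M)$ of $M$ is the (well-defined) dimension of a chief factor $C/D$ of $L$, where $C$ is minimal in the set of ideals of $L$ supplementing $M$, i.e. minimal among ideals $C$ with $L = M + C$ (so that $D \subseteq C\cap M$). Here $\dim(L/M)$ is the dimension of the quotient vector space. *)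

theory Defs
  imports "HOL-Algebra.Module" "HOL-Algebra.QuotRing"
begin

text \<open>
  A Lie algebra over a field \<open>F\<close> is carried by the library record for modules. Its field
  \<^const>\<open>mult\<close> (written \<open>x \<otimes>\<^bsub>L\<^esub> y\<close>) is the Lie bracket \<open>[x, y]\<close>; its field
  \<^const>\<open>one\<close> has no meaning and never enters any definition below. The library
  locale \<^locale>\<open>module\<close> puts no condition on these two fields.
\<close>

locale lie_algebra = F?: field F + L?: module F L for F (structure) and L (structure) +
  assumes bracket_closed:
      "\<lbrakk>x \<in> carrier L; y \<in> carrier L\<rbrakk> \<Longrightarrow> x \<otimes>\<^bsub>L\<^esub> y \<in> carrier L"
    and bracket_add_left:
      "\<lbrakk>x \<in> carrier L; y \<in> carrier L; z \<in> carrier L\<rbrakk>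
        \<Longrightarrow> (x \<oplus>\<^bsub>L\<^esub> y) \<otimes>\<^bsub>L\<^esub> z = x \<otimes>\<^bsub>L\<^esub> z \<oplus>\<^bsub>L\<^esub> y \<otimes>\<^bsub>L\<^esub> z"
    and bracket_add_right:
      "\<lbrakk>x \<in> carrier L; y \<in> carrier L; z \<in> carrier L\<rbrakk>
        \<Longrightarrow> x \<otimes>\<^bsub>L\<^esub> (y \<oplus>\<^bsub>L\<^esub> z) = x \<otimes>\<^bsub>L\<^esub> y \<oplus>\<^bsub>L\<^esub> x \<otimes>\<^bsub>L\<^esub> z"
    and bracket_smult_left:
      "\<lbrakk>a \<in> carrier F; x \<in> carrier L; y \<in> carrier L\<rbrakk>
        \<Longrightarrow> (a \<odot>\<^bsub>L\<^esub> x) \<otimes>\<^bsub>L\<^esub> y = a \<odot>\<^bsub>L\<^esub> (x \<otimes>\<^bsub>L\<^esub> y)"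
    and bracket_smult_right:
      "\<lbrakk>a \<in> carrier F; x \<in> carrier L; y \<in> carrier L\<rbrakk>
        \<Longrightarrow> x \<otimes>\<^bsub>L\<^esub> (a \<odot>\<^bsub>L\<^esub> y) = a \<odot>\<^bsub>L\<^esub> (x \<otimes>\<^bsub>L\<^esub> y)"
    and bracket_self:
      "x \<in> carrier L \<Longrightarrow> x \<otimes>\<^bsub>L\<^esub> x = \<zero>\<^bsub>L\<^esub>"
    and jacobi:
      "\<lbrakk>x \<in> carrier L; y \<in> carrier L; z \<in> carrier L\<rbrakk>
        \<Longrightarrow> x \<otimes>\<^bsub>L\<^esub> (y \<otimes>\<^bsub>L\<^esub> z) \<oplus>\<^bsub>L\<^esub> y \<otimes>\<^bsub>L\<^esub> (z \<otimes>\<^bsub>L\<^esub> x) \<oplus>\<^bsub>L\<^esub> z \<otimes>\<^bsub>L\<^esub> (x \<otimes>\<^bsub>L\<^esub> y) = \<zero>\<^bsub>L\<^esub>"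

definition is_basis :: "('a, 'c) ring_scheme \<Rightarrow> ('a, 'b, 'd) module_scheme \<Rightarrow> 'b set \<Rightarrow> bool" where
  "is_basis F V B \<longleftrightarrow> finite B \<and> B \<subseteq> carrier V \<and>
     (\<forall>c \<in> B \<rightarrow> carrier F. (\<Oplus>\<^bsub>V\<^esub>b\<in>B. c b \<odot>\<^bsub>V\<^esub> b) = \<zero>\<^bsub>V\<^esub> \<longrightarrow> (\<forall>b\<in>B. c b = \<zero>\<^bsub>F\<^esub>)) \<and>
     (\<forall>v \<in> carrier V. \<exists>c \<in> B \<rightarrow> carrier F. v = (\<Oplus>\<^bsub>V\<^esub>b\<in>B. c b \<odot>\<^bsub>V\<^esub> b))"

definition finite_dimensional :: "('a, 'c) ring_scheme \<Rightarrow> ('a, 'b, 'd) module_scheme \<Rightarrow> bool" where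
  "finite_dimensional F V \<longleftrightarrow> (\<exists>B. is_basis F V B)"

definition vdim :: "('a, 'c) ring_scheme \<Rightarrow> ('a, 'b, 'd) module_scheme \<Rightarrow> nat" where
  "vdim F V = (THE n. \<exists>B. is_basis F V B \<and> card B = n)"

text \<open>
  The set of cosets of \<open>W\<close> with the induced operations: the quotient vector space if \<open>W\<close> is a
  subspace, and the quotient Lie algebra if \<open>W\<close> is an ideal. For a subspace that is not an ideal
  the \<^const>\<open>mult\<close> field of the result is not meaningful.
\<close>

definition quotient_alg :: "('a, 'b, 'd) module_scheme \<Rightarrow> 'b set \<Rightarrow> ('a, 'b set) module" where
  "quotient_alg V W = ring.extend (V Quot W)
     (module.fields (\<lambda>a X. \<Union>x\<in>X. W +>\<^bsub>V\<^esub> (a \<odot>\<^bsub>V\<^esub> x)))"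

definition lie_subalgebra ::
    "('a, 'c) ring_scheme \<Rightarrow> ('a, 'b, 'd) module_scheme \<Rightarrow> 'b set \<Rightarrow> bool" where
  "lie_subalgebra F L B \<longleftrightarrow> submodule B F L \<and> (\<forall>x\<in>B. \<forall>y\<in>B. x \<otimes>\<^bsub>L\<^esub> y \<in> B)"

definition lie_ideal ::
    "('a, 'c) ring_scheme \<Rightarrow> ('a, 'b, 'd) module_scheme \<Rightarrow> 'b set \<Rightarrow> bool" where
  "lie_ideal F L I \<longleftrightarrow> submodule I F L \<and> (\<forall>x\<in>carrier L. \<forall>y\<in>I. x \<otimes>\<^bsub>L\<^esub> y \<in> I)"

definition minimal_lie_ideal ::
    "('a, 'c) ring_scheme \<Rightarrow> ('a, 'b, 'd) module_scheme \<Rightarrow> 'b set \<Rightarrow> bool" where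
  "minimal_lie_ideal F L I \<longleftrightarrow> lie_ideal F L I \<and> I \<noteq> {\<zero>\<^bsub>L\<^esub>} \<and>
     (\<forall>J. lie_ideal F L J \<and> J \<subseteq> I \<and> J \<noteq> {\<zero>\<^bsub>L\<^esub>} \<longrightarrow> J = I)"

definition maximal_lie_subalgebra ::
    "('a, 'c) ring_scheme \<Rightarrow> ('a, 'b, 'd) module_scheme \<Rightarrow> 'b set \<Rightarrow> bool" where
  "maximal_lie_subalgebra F L M \<longleftrightarrow> lie_subalgebra F L M \<and> M \<noteq> carrier L \<and>
     (\<forall>B. lie_subalgebra F L B \<and> M \<subseteq> B \<and> B \<noteq> carrier L \<longrightarrow> B = M)"

definition lie_core ::
    "('a, 'c) ring_scheme \<Rightarrow> ('a, 'b, 'd) module_scheme \<Rightarrow> 'b set \<Rightarrow> 'b set" where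
  "lie_core F L B = (GREATEST I. lie_ideal F L I \<and> I \<subseteq> B)"

definition c_ideal ::
    "('a, 'c) ring_scheme \<Rightarrow> ('a, 'b, 'd) module_scheme \<Rightarrow> 'b set \<Rightarrow> bool" where
  "c_ideal F L B \<longleftrightarrow> lie_subalgebra F L B \<and>
     (\<exists>C. lie_ideal F L C \<and> carrier L = B <+>\<^bsub>L\<^esub> C \<and> B \<inter> C \<subseteq> lie_core F L B)"

text \<open>
  For \<open>D \<subseteq> C\<close>, the carrier of \<open>quotient_alg (L\<lparr>carrier := C\<rparr>) D\<close> consists of the cosets
  \<open>D +>\<^bsub>L\<^esub> c\<close> with \<open>c \<in> C\<close>, so it is literally a subset of the carrier of \<open>quotient_alg L D\<close>.
\<close>

definition chief_factor ::
    "('a, 'c) ring_scheme \<Rightarrow> ('a, 'b, 'd) module_scheme \<Rightarrow> 'b set \<Rightarrow> 'b set \<Rightarrow> bool" where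
  "chief_factor F L C D \<longleftrightarrow> lie_ideal F L C \<and> lie_ideal F L D \<and> D \<subset> C \<and>
     minimal_lie_ideal F (quotient_alg L D) (carrier (quotient_alg (L\<lparr>carrier := C\<rparr>) D))"

definition c_section ::
    "('a, 'c) ring_scheme \<Rightarrow> ('a, 'b, 'd) module_scheme \<Rightarrow> 'b set \<Rightarrow> ('a, 'b set) module \<Rightarrow> bool" where
  "c_section F L M S \<longleftrightarrow> (\<exists>C D. chief_factor F L C D \<and> D \<subseteq> M \<and> carrier L = M <+>\<^bsub>L\<^esub> C \<and>
     S = quotient_alg (L\<lparr>carrier := M \<inter> C\<rparr>) D)"

text \<open>
  All c-sections of a maximal subalgebra are isomorphic, so an arbitrary one is chosen to represent
  their isomorphism type.
\<close>

definition Sec ::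
    "('a, 'c) ring_scheme \<Rightarrow> ('a, 'b, 'd) module_scheme \<Rightarrow> 'b set \<Rightarrow> ('a, 'b set) module" where
  "Sec F L M = (SOME S. c_section F L M S)"

definition c_index ::
    "('a, 'c) ring_scheme \<Rightarrow> ('a, 'b, 'd) module_scheme \<Rightarrow> 'b set \<Rightarrow> nat" where
  "c_index F L M = vdim F (Sec F L M)"

definition minimal_supplement ::
    "('a, 'c) ring_scheme \<Rightarrow> ('a, 'b, 'd) module_scheme \<Rightarrow> 'b set \<Rightarrow> 'b set \<Rightarrow> bool" where
  "minimal_supplement F L M C \<longleftrightarrow> lie_ideal F L C \<and> carrier L = M <+>\<^bsub>L\<^esub> C \<and>
     (\<forall>C'. lie_ideal F L C' \<and> carrier L = M <+>\<^bsub>L\<^esub> C' \<and> C' \<subseteq> C \<longrightarrow> C' = C)"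

definition ideal_index ::
    "('a, 'c) ring_scheme \<Rightarrow> ('a, 'b, 'd) module_scheme \<Rightarrow> 'b set \<Rightarrow> nat" where
  "ideal_index F L M = (THE n. \<exists>C D. minimal_supplement F L M C \<and> chief_factor F L C D \<and>
     n = vdim F (quotient_alg (L\<lparr>carrier := C\<rparr>) D))"

end

theory Submission
  imports Defs
begin

text \<open>
  Let \<open>K\<close> be the core of \<open>M\<close>. A chief factor \<open>C/D\<close> with \<open>D \<subseteq> M\<close> and \<open>L = M + C\<close> has \<open>D = K \<inter> C\<close>, and
  \<open>dim (C/D) = dim ((M \<inter> C)/D) + dim (L/M)\<close> since \<open>C/(M \<inter> C) \<cong> L/M\<close>. Everything therefore reduces to
  the independence of \<open>dim (C/D)\<close> from the choice of \<open>C/D\<close>. Given a second such factor \<open>C'/D'\<close>, either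
  \<open>K + C = K + C'\<close>, and both factors are isomorphic to \<open>(K + C)/K\<close>; or \<open>M \<inter> C = D\<close> and \<open>M \<inter> C' = D'\<close>,
  and both are isomorphic to \<open>L/M\<close>. The second case arises because \<open>M \<inter> C\<close> is stable under \<open>M\<close> and is
  bracketed into \<open>D\<close> by \<open>C'\<close>, hence is an ideal inside \<open>M\<close>. The same argument, with an ideal
  witnessing that \<open>M\<close> is a c-ideal in place of \<open>C'\<close>, shows that the c-section of a c-ideal vanishes.
\<close>

subsection \<open>Relative dimension of subspaces\<close>

text \<open>For \<open>v\<close> outside a subspace \<open>U\<close> this is a subspace covering
  \<open>U\<close>, the elementary link of a flag. It takes the space as an argument because it is
  also formed in restricted and quotient spaces.\<close>

definition line_ext ::
    "('a, 'c) ring_scheme \<Rightarrow> ('a, 'b, 'd) module_scheme \<Rightarrow> 'b \<Rightarrow> 'b set \<Rightarrow> 'b set" where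
  "line_ext F V v U = {u \<oplus>\<^bsub>V\<^esub> a \<odot>\<^bsub>V\<^esub> v | u a. u \<in> U \<and> a \<in> carrier F}"

text \<open>
  \<open>reldim F V U W n\<close> expresses \<open>dim (W / U) = n\<close> by a flag from \<open>U\<close> to \<open>W\<close> inside \<open>V\<close>, so that
  dimensions can be compared without leaving \<open>V\<close>.
\<close>
inductive reldim ::
    "('a, 'c) ring_scheme \<Rightarrow> ('a, 'b, 'd) module_scheme \<Rightarrow> 'b set \<Rightarrow> 'b set \<Rightarrow> nat \<Rightarrow> bool"
  for F V U where
  refl: "reldim F V U U 0"
| step: "\<lbrakk>reldim F V U W n; v \<in> carrier V; v \<notin> W\<rbrakk> \<Longrightarrow> reldim F V U (line_ext F V v W) (Suc n)"

text \<open>The linear algebra is set up for any vector space, so that it can be interpreted again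
  for restrictions to a subspace and for quotients.\<close>

locale field_module = F?: field F + V?: module F V for F (structure) and V (structure)
begin

section \<open>Subspaces, their sums, and extensions by one vector\<close>

abbreviation sub :: "'c set \<Rightarrow> bool" where
  "sub H \<equiv> submodule H F V"

abbreviation ext :: "'c \<Rightarrow> 'c set \<Rightarrow> 'c set" where
  "ext \<equiv> line_ext F V"

lemma sub_mem_carrier: "\<lbrakk>sub H; x \<in> H\<rbrakk> \<Longrightarrow> x \<in> carrier V"
  using submoduleE(1) by blast

lemma sub_zero: "sub H \<Longrightarrow> \<zero>\<^bsub>V\<^esub> \<in> H"
  using submodule.axioms(1) subgroup.one_closed by fastforce

lemma sub_add: "\<lbrakk>sub H; x \<in> H; y \<in> H\<rbrakk> \<Longrightarrow> x \<oplus>\<^bsub>V\<^esub> y \<in> H"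
  by (rule submoduleE(5))

lemma sub_smult: "\<lbrakk>sub H; a \<in> carrier F; x \<in> H\<rbrakk> \<Longrightarrow> a \<odot>\<^bsub>V\<^esub> x \<in> H"
  by (rule submoduleE(4))

lemma sub_add_cancel:
  assumes "sub H" "x \<in> H" "y \<in> carrier V" "x \<oplus>\<^bsub>V\<^esub> y \<in> H"
  shows "y \<in> H"
proof -
  have "y = \<ominus>\<^bsub>V\<^esub> x \<oplus>\<^bsub>V\<^esub> (x \<oplus>\<^bsub>V\<^esub> y)"
    using assms sub_mem_carrier by (metis M.r_neg1)
  also have "\<dots> \<in> H"
    using assms submoduleE(3) sub_add by blast
  finally show ?thesis .
qed

lemma sub_smult_cancel:
  assumes "sub H" "a \<in> carrier F" "a \<noteq> \<zero>\<^bsub>F\<^esub>" "v \<in> carrier V" "a \<odot>\<^bsub>V\<^esub> v \<in> H"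
  shows "v \<in> H"
proof -
  have a: "inv\<^bsub>F\<^esub> a \<in> carrier F" "inv\<^bsub>F\<^esub> a \<otimes>\<^bsub>F\<^esub> a = \<one>\<^bsub>F\<^esub>"
    using assms F.field_Units by auto
  have "v = inv\<^bsub>F\<^esub> a \<odot>\<^bsub>V\<^esub> (a \<odot>\<^bsub>V\<^esub> v)"
    using assms a V.smult_assoc1[of "inv\<^bsub>F\<^esub> a" a v] by simp
  also have "\<dots> \<in> H"
    using assms a sub_smult by blast
  finally show ?thesis .
qed

lemma sub_Int: "\<lbrakk>sub A; sub B\<rbrakk> \<Longrightarrow> sub (A \<inter> B)"
  by (rule V.submoduleI) (auto simp: sub_zero sub_add sub_smult dest: sub_mem_carrier submoduleE(3))

lemma sub_zero_singleton: "sub {\<zero>\<^bsub>V\<^esub>}"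
  by (rule V.submoduleI) auto

lemma mem_set_add: "x \<in> A <+>\<^bsub>V\<^esub> B \<longleftrightarrow> (\<exists>a\<in>A. \<exists>b\<in>B. x = a \<oplus>\<^bsub>V\<^esub> b)"
  by (auto simp: set_add_def set_mult_def)

lemma add_mem_set_add: "\<lbrakk>a \<in> A; b \<in> B\<rbrakk> \<Longrightarrow> a \<oplus>\<^bsub>V\<^esub> b \<in> A <+>\<^bsub>V\<^esub> B"
  by (auto simp: mem_set_add)

lemma add_add_swap:
  "\<lbrakk>a \<in> carrier V; b \<in> carrier V; c \<in> carrier V; d \<in> carrier V\<rbrakk>
    \<Longrightarrow> (a \<oplus>\<^bsub>V\<^esub> b) \<oplus>\<^bsub>V\<^esub> (c \<oplus>\<^bsub>V\<^esub> d) = (a \<oplus>\<^bsub>V\<^esub> c) \<oplus>\<^bsub>V\<^esub> (b \<oplus>\<^bsub>V\<^esub> d)"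
  by (simp add: M.a_ac)

lemma sub_set_add:
  assumes A: "sub A" and B: "sub B"
  shows "sub (A <+>\<^bsub>V\<^esub> B)"
proof (rule V.submoduleI)
  show "A <+>\<^bsub>V\<^esub> B \<subseteq> carrier V"
    using sub_mem_carrier[OF A] sub_mem_carrier[OF B] by (auto simp: mem_set_add)
  show "\<zero>\<^bsub>V\<^esub> \<in> A <+>\<^bsub>V\<^esub> B"
    using add_mem_set_add[OF sub_zero[OF A] sub_zero[OF B]] by simp
next
  fix x assume "x \<in> A <+>\<^bsub>V\<^esub> B"
  then obtain a b where x: "a \<in> A" "b \<in> B" "x = a \<oplus>\<^bsub>V\<^esub> b"
    by (auto simp: mem_set_add)
  then have "\<ominus>\<^bsub>V\<^esub> x = \<ominus>\<^bsub>V\<^esub> a \<oplus>\<^bsub>V\<^esub> \<ominus>\<^bsub>V\<^esub> b"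
    using sub_mem_carrier[OF A] sub_mem_carrier[OF B] M.minus_add by simp
  then show "\<ominus>\<^bsub>V\<^esub> x \<in> A <+>\<^bsub>V\<^esub> B"
    using x add_mem_set_add submoduleE(3) A B by metis
next
  fix x y assume "x \<in> A <+>\<^bsub>V\<^esub> B" "y \<in> A <+>\<^bsub>V\<^esub> B"
  then obtain a b c d where x: "a \<in> A" "b \<in> B" "x = a \<oplus>\<^bsub>V\<^esub> b"
    and y: "c \<in> A" "d \<in> B" "y = c \<oplus>\<^bsub>V\<^esub> d"
    by (auto simp: mem_set_add)
  then have "x \<oplus>\<^bsub>V\<^esub> y = (a \<oplus>\<^bsub>V\<^esub> c) \<oplus>\<^bsub>V\<^esub> (b \<oplus>\<^bsub>V\<^esub> d)"
    using sub_mem_carrier[OF A] sub_mem_carrier[OF B] add_add_swap by simp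
  then show "x \<oplus>\<^bsub>V\<^esub> y \<in> A <+>\<^bsub>V\<^esub> B"
    using x y add_mem_set_add sub_add A B by metis
next
  fix a x assume a: "a \<in> carrier F" and "x \<in> A <+>\<^bsub>V\<^esub> B"
  then obtain y z where x: "y \<in> A" "z \<in> B" "x = y \<oplus>\<^bsub>V\<^esub> z"
    by (auto simp: mem_set_add)
  then have "a \<odot>\<^bsub>V\<^esub> x = a \<odot>\<^bsub>V\<^esub> y \<oplus>\<^bsub>V\<^esub> a \<odot>\<^bsub>V\<^esub> z"
    using a sub_mem_carrier[OF A] sub_mem_carrier[OF B] V.smult_r_distr by simp
  then show "a \<odot>\<^bsub>V\<^esub> x \<in> A <+>\<^bsub>V\<^esub> B"
    using a x add_mem_set_add sub_smult A B by metis
qed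

lemma subset_set_add_left:
  assumes "A \<subseteq> carrier V" "sub B"
  shows "A \<subseteq> A <+>\<^bsub>V\<^esub> B"
proof
  fix x assume x: "x \<in> A"
  then have "x \<oplus>\<^bsub>V\<^esub> \<zero>\<^bsub>V\<^esub> = x"
    using assms by auto
  then show "x \<in> A <+>\<^bsub>V\<^esub> B"
    using add_mem_set_add[OF x sub_zero[OF assms(2)]] by simp
qed

lemma subset_set_add_right:
  assumes "sub A" "B \<subseteq> carrier V"
  shows "B \<subseteq> A <+>\<^bsub>V\<^esub> B"
proof
  fix x assume x: "x \<in> B"
  then have "\<zero>\<^bsub>V\<^esub> \<oplus>\<^bsub>V\<^esub> x = x"
    using assms by auto
  then show "x \<in> A <+>\<^bsub>V\<^esub> B"
    using add_mem_set_add[OF sub_zero[OF assms(1)] x] by simp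
qed

lemma set_add_least: "\<lbrakk>A \<subseteq> X; B \<subseteq> X; sub X\<rbrakk> \<Longrightarrow> A <+>\<^bsub>V\<^esub> B \<subseteq> X"
  by (auto simp: mem_set_add intro!: sub_add)

lemma line_ext_eq_set_add: "ext v U = U <+>\<^bsub>V\<^esub> {a \<odot>\<^bsub>V\<^esub> v | a. a \<in> carrier F}"
  by (force simp: line_ext_def mem_set_add)

lemma sub_line:
  assumes v: "v \<in> carrier V"
  shows "sub {a \<odot>\<^bsub>V\<^esub> v | a. a \<in> carrier F}"
proof (rule V.submoduleI)
  show "\<zero>\<^bsub>V\<^esub> \<in> {a \<odot>\<^bsub>V\<^esub> v | a. a \<in> carrier F}"
    using v V.smult_l_null F.zero_closed by force
next
  fix x assume "x \<in> {a \<odot>\<^bsub>V\<^esub> v | a. a \<in> carrier F}"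
  then show "\<ominus>\<^bsub>V\<^esub> x \<in> {a \<odot>\<^bsub>V\<^esub> v | a. a \<in> carrier F}"
    using v V.smult_l_minus[symmetric] F.a_inv_closed by force
next
  fix x y assume "x \<in> {a \<odot>\<^bsub>V\<^esub> v | a. a \<in> carrier F}" "y \<in> {a \<odot>\<^bsub>V\<^esub> v | a. a \<in> carrier F}"
  then show "x \<oplus>\<^bsub>V\<^esub> y \<in> {a \<odot>\<^bsub>V\<^esub> v | a. a \<in> carrier F}"
    using v V.smult_l_distr[symmetric] by force
next
  fix a x assume "a \<in> carrier F" "x \<in> {a \<odot>\<^bsub>V\<^esub> v | a. a \<in> carrier F}"
  then show "a \<odot>\<^bsub>V\<^esub> x \<in> {a \<odot>\<^bsub>V\<^esub> v | a. a \<in> carrier F}"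
    using v V.smult_assoc1[symmetric] by force
qed (use v in auto)

lemma sub_line_ext: "\<lbrakk>sub U; v \<in> carrier V\<rbrakk> \<Longrightarrow> sub (ext v U)"
  unfolding line_ext_eq_set_add by (intro sub_set_add sub_line)

lemma subset_line_ext: "\<lbrakk>sub U; v \<in> carrier V\<rbrakk> \<Longrightarrow> U \<subseteq> ext v U"
  unfolding line_ext_eq_set_add by (intro subset_set_add_left sub_line submoduleE(1))

lemma mem_line_ext:
  assumes "sub U" "v \<in> carrier V"
  shows "v \<in> ext v U"
proof -
  have "v = \<zero>\<^bsub>V\<^esub> \<oplus>\<^bsub>V\<^esub> \<one>\<^bsub>F\<^esub> \<odot>\<^bsub>V\<^esub> v"
    using assms by simp
  then show ?thesis
    unfolding line_ext_def using sub_zero[OF assms(1)] F.one_closed by blast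
qed

lemma line_ext_least: "\<lbrakk>sub W; U \<subseteq> W; v \<in> W\<rbrakk> \<Longrightarrow> ext v U \<subseteq> W"
  by (auto simp: line_ext_def intro!: sub_add sub_smult)

text \<open>A vector of \<open>W\<close> outside \<open>U\<close> has a nonzero coefficient at
  \<open>v\<close>; dividing by it puts \<open>v\<close> itself into \<open>W\<close>.\<close>

lemma line_ext_cover:
  assumes U: "sub U" and v: "v \<in> carrier V" and W: "sub W"
    and UW: "U \<subseteq> W" and WE: "W \<subseteq> ext v U" and ne: "W \<noteq> U"
  shows "W = ext v U"
proof -
  obtain w where w: "w \<in> W" "w \<notin> U"
    using UW ne by blast
  then obtain u a where ua: "u \<in> U" "a \<in> carrier F" "w = u \<oplus>\<^bsub>V\<^esub> a \<odot>\<^bsub>V\<^esub> v"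
    using WE by (auto simp: line_ext_def)
  have "a \<noteq> \<zero>\<^bsub>F\<^esub>"
    using ua w v sub_mem_carrier[OF U] by auto
  moreover have "a \<odot>\<^bsub>V\<^esub> v \<in> W"
    using sub_add_cancel[OF W, of u "a \<odot>\<^bsub>V\<^esub> v"] ua w v UW by auto
  ultimately have "v \<in> W"
    using sub_smult_cancel[OF W] ua v by blast
  then show ?thesis
    using line_ext_least[OF W UW] WE by blast
qed

text \<open>Both sides are the least subspace containing \<open>U\<close>, \<open>W\<close> and
  \<open>v\<close>.\<close>

lemma line_ext_set_add:
  assumes "sub U" "sub W" "v \<in> carrier V"
  shows "ext v U <+>\<^bsub>V\<^esub> W = ext v (U <+>\<^bsub>V\<^esub> W)"
proof -
  have UW: "sub (U <+>\<^bsub>V\<^esub> W)" and E: "sub (ext v (U <+>\<^bsub>V\<^esub> W))" and EW: "sub (ext v U <+>\<^bsub>V\<^esub> W)"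
    using assms by (auto intro: sub_set_add sub_line_ext)
  have c: "U \<subseteq> carrier V" "W \<subseteq> carrier V" "ext v U \<subseteq> carrier V"
    using assms submoduleE(1) sub_line_ext by blast+
  have 1: "U \<subseteq> U <+>\<^bsub>V\<^esub> W" "W \<subseteq> U <+>\<^bsub>V\<^esub> W" "ext v U \<subseteq> ext v U <+>\<^bsub>V\<^esub> W" "W \<subseteq> ext v U <+>\<^bsub>V\<^esub> W"
    using assms c subset_set_add_left subset_set_add_right sub_line_ext by metis+
  note 2 = subset_line_ext[OF UW assms(3)] mem_line_ext[OF UW assms(3)]
    subset_line_ext[OF assms(1,3)] mem_line_ext[OF assms(1,3)]
  show ?thesis
  proof
    show "ext v U <+>\<^bsub>V\<^esub> W \<subseteq> ext v (U <+>\<^bsub>V\<^esub> W)"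
      using 1 2 by (intro set_add_least line_ext_least E) auto
    show "ext v (U <+>\<^bsub>V\<^esub> W) \<subseteq> ext v U <+>\<^bsub>V\<^esub> W"
      using 1 2 by (intro set_add_least line_ext_least EW) auto
  qed
qed

section \<open>Flags and the uniqueness of their length\<close>

lemma reldim_sub: "\<lbrakk>reldim F V U W n; sub U\<rbrakk> \<Longrightarrow> sub W"
  by (induction rule: reldim.induct) (auto intro: sub_line_ext)

lemma reldim_subset: "\<lbrakk>reldim F V U W n; sub U\<rbrakk> \<Longrightarrow> U \<subseteq> W"
  by (induction rule: reldim.induct) (use subset_line_ext reldim_sub in blast)+

text \<open>The upper flag is the first premise because the induction runs over its links, each of
  which is put on top of the lower flag.\<close>

lemma reldim_trans:
  "\<lbrakk>reldim F V W X n; reldim F V U W m\<rbrakk> \<Longrightarrow> reldim F V U X (m + n)"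
  by (induction rule: reldim.induct) (auto intro: reldim.step)

text \<open>A last link would put its vector \<open>v\<close> into \<open>U\<close>, which is
  contained in the space just below that link, although \<open>v\<close> lies outside that
  space.\<close>

lemma reldim_self:
  assumes "reldim F V U U n" "sub U"
  shows "n = 0"
  using assms(1)
proof cases
  case (step W m v)
  then show ?thesis
    using assms(2) reldim_subset[OF step(3)] reldim_sub[OF step(3)] mem_line_ext[of W v] by blast
qed simp

text \<open>The space below the last link lies between \<open>U\<close> and \<open>ext v U\<close>
  and is not the latter, so by covering it is \<open>U\<close>, and there is exactly one
  link.\<close>

lemma reldim_line_ext:
  assumes "reldim F V U (ext v U) n" "sub U" "v \<in> carrier V" "v \<notin> U"
  shows "n = 1"
  using assms(1)
proof cases
  case refl
  then show ?thesis
    using assms mem_line_ext by auto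
next
  case (step W m w)
  have W: "sub W" "U \<subseteq> W" "W \<subseteq> ext v U" "W \<noteq> ext v U"
    using step reldim_sub[OF _ assms(2)] reldim_subset[OF _ assms(2)] subset_line_ext mem_line_ext
    by metis+
  then have "W = U"
    using line_ext_cover assms(2,3) by blast
  then show ?thesis
    using step reldim_self assms(2) by auto
qed

text \<open>The second isomorphism theorem for flags: adding \<open>W\<close> to every space of the
  flag keeps each link proper.\<close>

lemma reldim_second_iso:
  assumes "reldim F V U X n" "sub U" "sub W" "X \<inter> W = U"
  shows "reldim F V W (X <+>\<^bsub>V\<^esub> W) n"
  using assms
proof (induction rule: reldim.induct)
  case refl
  then have "U \<subseteq> W" by blast
  then have "U <+>\<^bsub>V\<^esub> W = W"
    using set_add_least[of U W W] subset_set_add_right[of U W] refl submoduleE(1) by blast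
  then show ?case
    by (simp add: reldim.refl)
next
  case (step X n v)
  have X: "sub X" "U \<subseteq> X"
    using step reldim_sub reldim_subset by blast+
  have XE: "X \<subseteq> ext v X" and vE: "v \<in> ext v X"
    using X step subset_line_ext mem_line_ext by blast+
  have "X \<inter> W = U"
    using step X XE by blast
  then have IH: "reldim F V W (X <+>\<^bsub>V\<^esub> W) n"
    using step by blast
  \<comment> \<open>Otherwise the \<open>W\<close>-component of \<open>v\<close> lies in both
    \<open>ext v X\<close> and \<open>W\<close>, hence in \<open>U\<close> and in \<open>X\<close>,
    which forces \<open>v\<close> into \<open>X\<close>.\<close>
  have "v \<notin> X <+>\<^bsub>V\<^esub> W"
  proof
    assume "v \<in> X <+>\<^bsub>V\<^esub> W"
    then obtain x w where xw: "x \<in> X" "w \<in> W" "v = x \<oplus>\<^bsub>V\<^esub> w"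
      by (auto simp: mem_set_add)
    have "w \<in> ext v X"
      using sub_add_cancel[OF sub_line_ext[OF X(1) step(2)], of x w] xw XE vE
        sub_mem_carrier[OF step(6)] by auto
    then have "w \<in> X"
      using xw step X by blast
    then show False
      using xw step sub_add X by blast
  qed
  then show ?case
    using reldim.step[OF IH step(2)] line_ext_set_add X step by metis
qed

text \<open>The inductive step intersects the chain with \<open>W\<close>: the last link either survives in \<open>W\<close>,
  or is moved above \<open>W\<close> by the second isomorphism theorem.\<close>
lemma reldim_split:
  assumes "reldim F V U X n" "sub U" "sub W" "U \<subseteq> W" "W \<subseteq> X"
  shows "\<exists>k\<le>n. reldim F V U W k \<and> reldim F V W X (n - k)"
  using assms
proof (induction arbitrary: W rule: reldim.induct)
  case refl
  then have "W = U" by blast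
  then show ?case
    by (auto intro: reldim.refl)
next
  case (step X n v)
  have X: "sub X" "U \<subseteq> X"
    using step reldim_sub reldim_subset by blast+
  have WX: "sub (W \<inter> X)" "U \<subseteq> W \<inter> X"
    using sub_Int step X by auto
  then obtain k where k: "k \<le> n" "reldim F V U (W \<inter> X) k" "reldim F V (W \<inter> X) X (n - k)"
    using step by (metis inf_le2)
  show ?case
  proof (cases "W \<subseteq> X")
    case True
    then have "W \<inter> X = W" by blast
    then have "reldim F V U W k" "reldim F V W (ext v X) (Suc n - k)"
      using k step reldim.step[of F V W X "n - k" v] by (auto simp: Suc_diff_le)
    then show ?thesis
      using k by (metis le_SucI)
  next
    case False
    then obtain w where w: "w \<in> W" "w \<notin> X" by blast
    have wc: "w \<in> carrier V"
      using w sub_mem_carrier step by blast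
    have E: "sub (ext v X)" "X \<subseteq> ext v X"
      using X step sub_line_ext subset_line_ext by auto
    \<comment> \<open>By covering, the last link is also generated by \<open>w\<close>, and a
      generator taken from \<open>W\<close> lets the link be seen inside \<open>W\<close>.\<close>
    have wE: "ext w X = ext v X"
    proof (rule line_ext_cover[OF X(1) step(2)])
      show "ext w X \<noteq> X"
        using mem_line_ext[OF X(1) wc] w by blast
      show "ext w X \<subseteq> ext v X"
        using line_ext_least[OF E] w step by blast
    qed (use sub_line_ext subset_line_ext X wc in auto)
    have ww: "ext w (W \<inter> X) = W"
    proof
      show "ext w (W \<inter> X) \<subseteq> W"
        using line_ext_least w step by auto
      show "W \<subseteq> ext w (W \<inter> X)"
      proof
        fix y assume y: "y \<in> W"
        then have "y \<in> ext w X"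
          using wE step by auto
        then obtain x a where xa: "x \<in> X" "a \<in> carrier F" "y = x \<oplus>\<^bsub>V\<^esub> a \<odot>\<^bsub>V\<^esub> w"
          by (auto simp: line_ext_def)
        have xc: "x \<in> carrier V" using X xa sub_mem_carrier by blast
        have aw: "a \<odot>\<^bsub>V\<^esub> w \<in> W"
          using sub_smult step xa w by blast
        have "a \<odot>\<^bsub>V\<^esub> w \<oplus>\<^bsub>V\<^esub> x \<in> W"
          using y xa xc wc M.a_comm by simp
        then have "x \<in> W"
          using sub_add_cancel aw xc step by blast
        then show "y \<in> ext w (W \<inter> X)"
          using xa by (auto simp: line_ext_def)
      qed
    qed
    have 1: "reldim F V U W (Suc k)"
      using reldim.step[OF k(2) wc] w ww by simp
    \<comment> \<open>This sum is where the flag of length \<open>n - k\<close> from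
      \<open>W \<inter> X\<close> to \<open>X\<close> ends once it is moved above \<open>W\<close>.
      The extra link is counted below \<open>W\<close>, and
      \<open>Suc n - Suc k = n - k\<close>.\<close>
    have "X <+>\<^bsub>V\<^esub> W = ext v X"
    proof
      show "X <+>\<^bsub>V\<^esub> W \<subseteq> ext v X"
        using set_add_least E step by blast
      show "ext v X \<subseteq> X <+>\<^bsub>V\<^esub> W"
      proof -
        have "X \<subseteq> X <+>\<^bsub>V\<^esub> W" "W \<subseteq> X <+>\<^bsub>V\<^esub> W"
          using subset_set_add_left[OF submoduleE(1)[OF X(1)] step(6)]
            subset_set_add_right[OF X(1) submoduleE(1)[OF step(6)]] by simp_all
        then show ?thesis
          unfolding wE[symmetric]
          using line_ext_least[OF sub_set_add[OF X(1) step(6)]] w by blast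
      qed
    qed
    then have "reldim F V W (ext v X) (n - k)"
      using reldim_second_iso[OF k(3) WX(1) step(6)] by (simp add: Int_commute)
    then show ?thesis
      using 1 k by (intro exI[of _ "Suc k"]) auto
  qed
qed

text \<open>As for the Jordan-Hoelder theorem: the space \<open>W\<close> below the last link of the
  second flag splits the first one. The piece above \<open>W\<close> has length one, and the
  induction hypothesis compares the pieces below.\<close>

lemma reldim_unique:
  assumes "reldim F V U X n" "reldim F V U X m" "sub U"
  shows "n = m"
  using assms
proof (induction m arbitrary: n X)
  case 0
  then have "X = U"
    using reldim.cases by blast
  then show ?case
    using 0 reldim_self by auto
next
  case (Suc m)
  from Suc(3) obtain W v where W: "reldim F V U W m" "v \<in> carrier V" "v \<notin> W" "X = ext v W"
    by cases auto
  have sW: "sub W" "U \<subseteq> W" "W \<subseteq> X"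
    using W reldim_sub reldim_subset subset_line_ext Suc(4) by blast+
  obtain k where k: "k \<le> n" "reldim F V U W k" "reldim F V W X (n - k)"
    using reldim_split[OF Suc(2) Suc(4) sW] by blast
  have "n - k = 1"
    using reldim_line_ext k(3) W sW by blast
  moreover have "k = m"
    using Suc k W by blast
  ultimately show ?case
    by simp
qed

subsection \<open>Bases and quotient spaces\<close>

text \<open>Together with \<open>lin_indep\<close> this splits \<open>is_basis\<close> into two
  notions that can be followed while vectors are inserted one at a time.\<close>

definition lin_span :: "'c set \<Rightarrow> 'c set" where
  "lin_span B = {\<Oplus>\<^bsub>V\<^esub>b\<in>B. c b \<odot>\<^bsub>V\<^esub> b | c. c \<in> B \<rightarrow> carrier F}"

definition lin_indep :: "'c set \<Rightarrow> bool" where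
  "lin_indep B \<longleftrightarrow>
    (\<forall>c \<in> B \<rightarrow> carrier F. (\<Oplus>\<^bsub>V\<^esub>b\<in>B. c b \<odot>\<^bsub>V\<^esub> b) = \<zero>\<^bsub>V\<^esub> \<longrightarrow> (\<forall>b\<in>B. c b = \<zero>\<^bsub>F\<^esub>))"

lemma lin_comb_closed:
  "\<lbrakk>B \<subseteq> carrier V; c \<in> B \<rightarrow> carrier F\<rbrakk> \<Longrightarrow> (\<Oplus>\<^bsub>V\<^esub>b\<in>B. c b \<odot>\<^bsub>V\<^esub> b) \<in> carrier V"
  by (rule M.finsum_closed) auto

lemma lin_comb_insert:
  assumes "finite B" "B \<subseteq> carrier V" "v \<in> carrier V" "v \<notin> B"
    "c \<in> B \<rightarrow> carrier F" "a \<in> carrier F"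
  shows "(\<Oplus>\<^bsub>V\<^esub>b\<in>insert v B. (c(v := a)) b \<odot>\<^bsub>V\<^esub> b) =
    a \<odot>\<^bsub>V\<^esub> v \<oplus>\<^bsub>V\<^esub> (\<Oplus>\<^bsub>V\<^esub>b\<in>B. c b \<odot>\<^bsub>V\<^esub> b)"
proof -
  have cl: "(\<lambda>b. c b \<odot>\<^bsub>V\<^esub> b) \<in> B \<rightarrow> carrier V"
    using assms by auto
  have "(\<Oplus>\<^bsub>V\<^esub>b\<in>B. (c(v := a)) b \<odot>\<^bsub>V\<^esub> b) = (\<Oplus>\<^bsub>V\<^esub>b\<in>B. c b \<odot>\<^bsub>V\<^esub> b)"
    using assms by (intro M.finsum_cong' cl) auto
  moreover have "(\<Oplus>\<^bsub>V\<^esub>b\<in>insert v B. (c(v := a)) b \<odot>\<^bsub>V\<^esub> b) =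
      (c(v := a)) v \<odot>\<^bsub>V\<^esub> v \<oplus>\<^bsub>V\<^esub> (\<Oplus>\<^bsub>V\<^esub>b\<in>B. (c(v := a)) b \<odot>\<^bsub>V\<^esub> b)"
    using assms by (intro M.finsum_insert) (auto simp: Pi_def)
  ultimately show ?thesis
    by simp
qed

lemma lin_comb_insert_Pi:
  assumes "finite B" "B \<subseteq> carrier V" "v \<in> carrier V" "v \<notin> B" "c \<in> insert v B \<rightarrow> carrier F"
  shows "(\<Oplus>\<^bsub>V\<^esub>b\<in>insert v B. c b \<odot>\<^bsub>V\<^esub> b) = c v \<odot>\<^bsub>V\<^esub> v \<oplus>\<^bsub>V\<^esub> (\<Oplus>\<^bsub>V\<^esub>b\<in>B. c b \<odot>\<^bsub>V\<^esub> b)"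
  using lin_comb_insert[of B v c "c v"] assms by simp

lemma lin_span_empty: "lin_span {} = {\<zero>\<^bsub>V\<^esub>}"
  by (auto simp: lin_span_def)

lemma lin_span_insert:
  assumes "finite B" "B \<subseteq> carrier V" "v \<in> carrier V" "v \<notin> B"
  shows "lin_span (insert v B) = ext v (lin_span B)"
proof
  show "lin_span (insert v B) \<subseteq> ext v (lin_span B)"
  proof
    fix x assume "x \<in> lin_span (insert v B)"
    then obtain c where c: "c \<in> insert v B \<rightarrow> carrier F" "x = (\<Oplus>\<^bsub>V\<^esub>b\<in>insert v B. c b \<odot>\<^bsub>V\<^esub> b)"
      by (auto simp: lin_span_def)
    then have "x = (\<Oplus>\<^bsub>V\<^esub>b\<in>B. c b \<odot>\<^bsub>V\<^esub> b) \<oplus>\<^bsub>V\<^esub> c v \<odot>\<^bsub>V\<^esub> v"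
      using lin_comb_insert_Pi[OF assms c(1)] assms lin_comb_closed[of B c] M.a_comm by auto
    moreover have "c \<in> B \<rightarrow> carrier F" "c v \<in> carrier F"
      using c by auto
    ultimately show "x \<in> ext v (lin_span B)"
      by (auto simp: line_ext_def lin_span_def)
  qed
  show "ext v (lin_span B) \<subseteq> lin_span (insert v B)"
  proof
    fix x assume "x \<in> ext v (lin_span B)"
    then obtain c a where c: "c \<in> B \<rightarrow> carrier F" "a \<in> carrier F"
      "x = (\<Oplus>\<^bsub>V\<^esub>b\<in>B. c b \<odot>\<^bsub>V\<^esub> b) \<oplus>\<^bsub>V\<^esub> a \<odot>\<^bsub>V\<^esub> v"
      by (auto simp: line_ext_def lin_span_def)
    then have "x = (\<Oplus>\<^bsub>V\<^esub>b\<in>insert v B. (c(v := a)) b \<odot>\<^bsub>V\<^esub> b)"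
      using lin_comb_insert[OF assms c(1,2)] assms lin_comb_closed[of B c] M.a_comm by auto
    moreover have "c(v := a) \<in> insert v B \<rightarrow> carrier F"
      using c by auto
    ultimately show "x \<in> lin_span (insert v B)"
      unfolding lin_span_def by blast
  qed
qed

lemma sub_lin_span: "\<lbrakk>finite B; B \<subseteq> carrier V\<rbrakk> \<Longrightarrow> sub (lin_span B)"
proof (induction rule: finite_induct)
  case empty
  then show ?case
    by (simp add: lin_span_empty sub_zero_singleton)
next
  case (insert v B)
  then show ?case
    by (simp add: lin_span_insert sub_line_ext)
qed

lemma lin_indep_insert:
  assumes B: "finite B" "B \<subseteq> carrier V" "v \<in> carrier V" "v \<notin> B"
  shows "lin_indep (insert v B) \<longleftrightarrow> lin_indep B \<and> v \<notin> lin_span B"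
proof
  assume ind: "lin_indep (insert v B)"
  have "\<forall>b\<in>B. c b = \<zero>\<^bsub>F\<^esub>" if c: "c \<in> B \<rightarrow> carrier F" "(\<Oplus>\<^bsub>V\<^esub>b\<in>B. c b \<odot>\<^bsub>V\<^esub> b) = \<zero>\<^bsub>V\<^esub>" for c
  proof -
    \<comment> \<open>A relation on \<open>B\<close> is extended by the coefficient zero at
      \<open>v\<close>.\<close>
    have "(\<Oplus>\<^bsub>V\<^esub>b\<in>insert v B. (c(v := \<zero>\<^bsub>F\<^esub>)) b \<odot>\<^bsub>V\<^esub> b) = \<zero>\<^bsub>V\<^esub>"
      using lin_comb_insert[OF B c(1) F.zero_closed] c B by simp
    moreover have "c(v := \<zero>\<^bsub>F\<^esub>) \<in> insert v B \<rightarrow> carrier F"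
      using c by auto
    ultimately have "\<forall>b\<in>insert v B. (c(v := \<zero>\<^bsub>F\<^esub>)) b = \<zero>\<^bsub>F\<^esub>"
      using ind unfolding lin_indep_def by blast
    then show ?thesis
      using B by (auto split: if_splits)
  qed
  then have 1: "lin_indep B"
    unfolding lin_indep_def by blast
  have "v \<notin> lin_span B"
  proof
    assume "v \<in> lin_span B"
    then obtain c where c: "c \<in> B \<rightarrow> carrier F" "v = (\<Oplus>\<^bsub>V\<^esub>b\<in>B. c b \<odot>\<^bsub>V\<^esub> b)"
      by (auto simp: lin_span_def)
    \<comment> \<open>The coefficient -1 at \<open>v\<close> turns the representation of
      \<open>v\<close> into a relation; independence would then give -1 = 0.\<close>
    let ?c = "c(v := \<ominus>\<^bsub>F\<^esub> \<one>\<^bsub>F\<^esub>)"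
    have "(\<Oplus>\<^bsub>V\<^esub>b\<in>insert v B. ?c b \<odot>\<^bsub>V\<^esub> b) = (\<ominus>\<^bsub>F\<^esub> \<one>\<^bsub>F\<^esub>) \<odot>\<^bsub>V\<^esub> v \<oplus>\<^bsub>V\<^esub> v"
      using lin_comb_insert[OF B c(1), of "\<ominus>\<^bsub>F\<^esub> \<one>\<^bsub>F\<^esub>"] c(2) by simp
    also have "\<dots> = \<zero>\<^bsub>V\<^esub>"
      using B V.smult_l_minus[of "\<one>\<^bsub>F\<^esub>" v] by (simp add: M.l_neg)
    finally have sum0: "(\<Oplus>\<^bsub>V\<^esub>b\<in>insert v B. ?c b \<odot>\<^bsub>V\<^esub> b) = \<zero>\<^bsub>V\<^esub>" .
    have "?c \<in> insert v B \<rightarrow> carrier F"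
      using c(1) by auto
    then have "\<forall>b\<in>insert v B. ?c b = \<zero>\<^bsub>F\<^esub>"
      using ind sum0 unfolding lin_indep_def by blast
    then have "\<ominus>\<^bsub>F\<^esub> \<one>\<^bsub>F\<^esub> = \<zero>\<^bsub>F\<^esub>"
      by simp
    then have "\<one>\<^bsub>F\<^esub> = \<zero>\<^bsub>F\<^esub>"
      using F.r_neg[OF F.one_closed] F.r_zero[OF F.one_closed] by simp
    then show False
      by simp
  qed
  with 1 show "lin_indep B \<and> v \<notin> lin_span B"
    by blast
next
  assume ind: "lin_indep B \<and> v \<notin> lin_span B"
  have "\<forall>b\<in>insert v B. c b = \<zero>\<^bsub>F\<^esub>"
    if c: "c \<in> insert v B \<rightarrow> carrier F" "(\<Oplus>\<^bsub>V\<^esub>b\<in>insert v B. c b \<odot>\<^bsub>V\<^esub> b) = \<zero>\<^bsub>V\<^esub>" for c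
  proof -
    let ?s = "\<Oplus>\<^bsub>V\<^esub>b\<in>B. c b \<odot>\<^bsub>V\<^esub> b"
    have cB: "c \<in> B \<rightarrow> carrier F" "c v \<in> carrier F"
      using c by auto
    have s: "?s \<in> lin_span B" "?s \<in> carrier V"
      using cB lin_comb_closed B by (auto simp: lin_span_def)
    have eq: "c v \<odot>\<^bsub>V\<^esub> v \<oplus>\<^bsub>V\<^esub> ?s = \<zero>\<^bsub>V\<^esub>"
      using lin_comb_insert_Pi[OF B c(1)] c(2) by simp
    then have "?s \<oplus>\<^bsub>V\<^esub> c v \<odot>\<^bsub>V\<^esub> v = \<zero>\<^bsub>V\<^esub>"
      using cB s B M.a_comm by simp
    then have "c v \<odot>\<^bsub>V\<^esub> v \<in> lin_span B"
      using sub_add_cancel[OF sub_lin_span[OF B(1,2)] s(1), of "c v \<odot>\<^bsub>V\<^esub> v"] cB B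
        sub_zero[OF sub_lin_span[OF B(1,2)]] by simp
    \<comment> \<open>A nonzero coefficient could be divided out, which would put \<open>v\<close>
      into the span.\<close>
    then have cv: "c v = \<zero>\<^bsub>F\<^esub>"
      using sub_smult_cancel[OF sub_lin_span[OF B(1,2)]] cB B ind by blast
    then have "?s = \<zero>\<^bsub>V\<^esub>"
      using eq s B by simp
    then show ?thesis
      using ind cB cv unfolding lin_indep_def by blast
  qed
  then show "lin_indep (insert v B)"
    unfolding lin_indep_def by blast
qed

lemma is_basis_iff:
  "is_basis F V B \<longleftrightarrow> finite B \<and> B \<subseteq> carrier V \<and> lin_indep B \<and> lin_span B = carrier V"
proof -
  have "lin_span B = carrier V \<longleftrightarrow>
      (\<forall>v \<in> carrier V. \<exists>c \<in> B \<rightarrow> carrier F. v = (\<Oplus>\<^bsub>V\<^esub>b\<in>B. c b \<odot>\<^bsub>V\<^esub> b))" if "B \<subseteq> carrier V"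
    using lin_comb_closed[OF that] unfolding lin_span_def by blast
  then show ?thesis
    unfolding is_basis_def lin_indep_def by blast
qed

section \<open>Dimension as the length of a flag from zero\<close>

lemma reldim_lin_span:
  "\<lbrakk>finite B; B \<subseteq> carrier V; lin_indep B\<rbrakk> \<Longrightarrow> reldim F V {\<zero>\<^bsub>V\<^esub>} (lin_span B) (card B)"
proof (induction rule: finite_induct)
  case empty
  then show ?case
    by (simp add: lin_span_empty reldim.refl)
next
  case (insert v B)
  then show ?case
    by (simp add: lin_span_insert lin_indep_insert reldim.step)
qed

text \<open>The vectors adjoined along the flag form the basis. With \<open>reldim_lin_span\<close>
  this identifies the sizes of bases with lengths of flags.\<close>

lemma reldim_imp_basis:
  "reldim F V {\<zero>\<^bsub>V\<^esub>} W n \<Longrightarrow>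
    \<exists>B. finite B \<and> B \<subseteq> carrier V \<and> lin_indep B \<and> lin_span B = W \<and> card B = n"
proof (induction rule: reldim.induct)
  case refl
  then show ?case
    by (intro exI[of _ "{}"]) (auto simp: lin_span_empty lin_indep_def)
next
  case (step W n v)
  then obtain B where B: "finite B" "B \<subseteq> carrier V" "lin_indep B" "lin_span B = W" "card B = n"
    by blast
  have "v \<notin> B"
  proof
    assume "v \<in> B"
    then have "lin_span B = ext v (lin_span (B - {v}))"
      using lin_span_insert[of "B - {v}" v] B by (auto simp: insert_absorb)
    then show False
      using step B mem_line_ext[OF sub_lin_span, of "B - {v}" v] by auto
  qed
  then show ?case
    using B step lin_span_insert lin_indep_insert by (intro exI[of _ "insert v B"]) auto
qed

text \<open>The uniqueness required by the definite description in \<open>vdim\<close> is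
  \<open>reldim_unique\<close>, transported to bases.\<close>

lemma vdim_eqI:
  assumes "reldim F V {\<zero>\<^bsub>V\<^esub>} (carrier V) n"
  shows "vdim F V = n"
  unfolding vdim_def
proof (rule the_equality)
  show "\<exists>B. is_basis F V B \<and> card B = n"
    using reldim_imp_basis[OF assms] is_basis_iff by blast
next
  fix m assume "\<exists>B. is_basis F V B \<and> card B = m"
  then have "reldim F V {\<zero>\<^bsub>V\<^esub>} (carrier V) m"
    using reldim_lin_span is_basis_iff by metis
  then show "m = n"
    using reldim_unique assms sub_zero_singleton by blast
qed

text \<open>A basis yields a flag from zero to the whole space; splitting it at \<open>U\<close>,
  and its upper piece at \<open>W\<close>, leaves the flag wanted.\<close>

lemma finite_dimensional_reldim:
  assumes "finite_dimensional F V" "sub U" "sub W" "U \<subseteq> W"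
  shows "\<exists>n. reldim F V U W n"
proof -
  obtain n where "reldim F V {\<zero>\<^bsub>V\<^esub>} (carrier V) n"
    using assms(1) reldim_lin_span is_basis_iff unfolding finite_dimensional_def by metis
  then obtain m where "reldim F V U (carrier V) m"
    using reldim_split[of "{\<zero>\<^bsub>V\<^esub>}" "carrier V" n U] assms sub_zero_singleton sub_zero submoduleE(1)
    by (metis empty_subsetI insert_subset)
  then show ?thesis
    using reldim_split[of U "carrier V" m W] assms submoduleE(1) by blast
qed

section \<open>Restriction to a subspace and passage to the quotient\<close>

lemma restrict_field_module:
  assumes "sub W"
  shows "field_module F (V\<lparr>carrier := W\<rparr>)"
  by (intro field_module.intro F.field_axioms submodule.submodule_is_module[OF assms V.module_axioms])

lemma restrict_submodule:
  assumes U: "sub U" and W: "sub W" and UW: "U \<subseteq> W"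
  shows "submodule U F (V\<lparr>carrier := W\<rparr>)"
proof -
  interpret W: field_module F "V\<lparr>carrier := W\<rparr>"
    by (rule restrict_field_module[OF W])
  show ?thesis
    by (rule W.V.module_incl_imp_submodule)
      (use UW submodule.submodule_is_module[OF U V.module_axioms] in auto)
qed

text \<open>Restriction keeps the operations, so a flag only has to have its vectors in the new
  carrier.\<close>

lemma reldim_restrict:
  assumes "reldim F V U X n" "sub U" "X \<subseteq> W"
  shows "reldim F (V\<lparr>carrier := W\<rparr>) U X n"
  using assms
proof (induction rule: reldim.induct)
  case refl
  then show ?case
    by (auto intro: reldim.refl)
next
  case (step X n v)
  have X: "sub X" "X \<subseteq> W" "v \<in> W"
    using step reldim_sub subset_line_ext mem_line_ext by blast+
  have "line_ext F (V\<lparr>carrier := W\<rparr>) v X = ext v X"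
    by (simp add: line_ext_def)
  then show ?case
    using reldim.step[of F "V\<lparr>carrier := W\<rparr>" U X n v] X step by simp
qed

lemma sub_abelian_subgroup:
  assumes "sub U"
  shows "abelian_subgroup U V"
  by (intro abelian_subgroupI3 additive_subgroup.intro submodule.axioms(1)[OF assms] M.abelian_group_axioms)

lemma coset_mem:
  assumes "sub U" "x \<in> carrier V" "y \<in> carrier V"
  shows "y \<in> U +>\<^bsub>V\<^esub> x \<longleftrightarrow> (\<exists>u\<in>U. y = u \<oplus>\<^bsub>V\<^esub> x)"
  by (auto simp: a_r_coset_def')

lemma coset_eq_iff:
  assumes "sub U" "x \<in> carrier V" "y \<in> carrier V"
  shows "U +>\<^bsub>V\<^esub> x = U +>\<^bsub>V\<^esub> y \<longleftrightarrow> (\<exists>u\<in>U. x = u \<oplus>\<^bsub>V\<^esub> y)"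
proof -
  interpret U: abelian_subgroup U V
    by (rule sub_abelian_subgroup[OF assms(1)])
  show ?thesis
    using coset_mem[OF assms(1,3,2)] U.a_rcos_self[OF assms(2)] U.a_repr_independence'[of x y] assms
    by auto
qed

lemma coset_eq_self_iff:
  assumes "sub U" "x \<in> carrier V"
  shows "U +>\<^bsub>V\<^esub> x = U \<longleftrightarrow> x \<in> U"
proof -
  interpret U: abelian_subgroup U V
    by (rule sub_abelian_subgroup[OF assms(1)])
  show ?thesis
    using assms U.a_rcos_self U.a_rcos_const by metis
qed

lemma quotient_carrier: "carrier (quotient_alg V U) = (\<lambda>x. U +>\<^bsub>V\<^esub> x) ` carrier V"
  by (auto simp: quotient_alg_def ring.defs FactRing_simps)

lemma quotient_carrier_restrict:
  "carrier (quotient_alg (V\<lparr>carrier := W\<rparr>) U) = (\<lambda>x. U +>\<^bsub>V\<^esub> x) ` W"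
  by (auto simp: quotient_alg_def ring.defs FactRing_simps a_r_coset_def' r_coset_def)

lemma quotient_zero: "\<zero>\<^bsub>quotient_alg V U\<^esub> = U"
  by (simp add: quotient_alg_def ring.defs FactRing_def)

lemma quotient_zero_restrict: "\<zero>\<^bsub>quotient_alg (V\<lparr>carrier := W\<rparr>) U\<^esub> = U"
  by (simp add: quotient_alg_def ring.defs FactRing_def)

lemma quotient_add:
  assumes "sub U" "x \<in> carrier V" "y \<in> carrier V"
  shows "(U +>\<^bsub>V\<^esub> x) \<oplus>\<^bsub>quotient_alg V U\<^esub> (U +>\<^bsub>V\<^esub> y) = U +>\<^bsub>V\<^esub> (x \<oplus>\<^bsub>V\<^esub> y)"
  using abelian_subgroup.a_rcos_sum[OF sub_abelian_subgroup] assms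
  by (simp add: quotient_alg_def ring.defs FactRing_def)

lemma quotient_smult:
  assumes U: "sub U" and a: "a \<in> carrier F" and x: "x \<in> carrier V"
  shows "a \<odot>\<^bsub>quotient_alg V U\<^esub> (U +>\<^bsub>V\<^esub> x) = U +>\<^bsub>V\<^esub> (a \<odot>\<^bsub>V\<^esub> x)"
proof -
  interpret U: abelian_subgroup U V
    by (rule sub_abelian_subgroup[OF U])
  \<comment> \<open>The union in \<open>quotient_alg\<close> runs over all representatives of the
    coset, so each of them must contribute the same coset.\<close>
  have "U +>\<^bsub>V\<^esub> (a \<odot>\<^bsub>V\<^esub> y) = U +>\<^bsub>V\<^esub> (a \<odot>\<^bsub>V\<^esub> x)" if y: "y \<in> U +>\<^bsub>V\<^esub> x" for y
  proof -
    obtain u where u: "u \<in> U" "y = u \<oplus>\<^bsub>V\<^esub> x"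
      using y by (auto simp: a_r_coset_def')
    have "u \<in> carrier V"
      using U u sub_mem_carrier by blast
    then have "a \<odot>\<^bsub>V\<^esub> y = a \<odot>\<^bsub>V\<^esub> u \<oplus>\<^bsub>V\<^esub> a \<odot>\<^bsub>V\<^esub> x" "y \<in> carrier V"
      using u a x V.smult_r_distr by auto
    then show ?thesis
      using coset_eq_iff[OF U] a x sub_smult[OF U] u by (metis V.smult_closed)
  qed
  then have "(\<Union>y\<in>U +>\<^bsub>V\<^esub> x. U +>\<^bsub>V\<^esub> (a \<odot>\<^bsub>V\<^esub> y)) = U +>\<^bsub>V\<^esub> (a \<odot>\<^bsub>V\<^esub> x)"
    using U.a_rcos_self[OF x] by blast
  then show ?thesis
    by (simp add: quotient_alg_def ring.defs module.defs)
qed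

lemma quotient_field_module:
  assumes U: "sub U"
  shows "field_module F (quotient_alg V U)"
proof -
  interpret U: abelian_subgroup U V
    by (rule sub_abelian_subgroup[OF U])
  note q = quotient_carrier quotient_zero quotient_add[OF U] quotient_smult[OF U]
  have "abelian_group (quotient_alg V U)"
  proof (rule abelian_groupI)
    show "\<zero>\<^bsub>quotient_alg V U\<^esub> \<in> carrier (quotient_alg V U)"
      using coset_eq_self_iff[OF U, of "\<zero>\<^bsub>V\<^esub>"] sub_zero[OF U] by (force simp: q)
    fix X assume "X \<in> carrier (quotient_alg V U)"
    then obtain x where x: "x \<in> carrier V" "X = U +>\<^bsub>V\<^esub> x"
      by (auto simp: q)
    have U0: "U = U +>\<^bsub>V\<^esub> \<zero>\<^bsub>V\<^esub>"
      using coset_eq_self_iff[OF U, of "\<zero>\<^bsub>V\<^esub>"] sub_zero[OF U] by simp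
    have "U \<oplus>\<^bsub>quotient_alg V U\<^esub> X = X"
      using quotient_add[OF U M.zero_closed x(1)] x U0 by simp
    then show "\<zero>\<^bsub>quotient_alg V U\<^esub> \<oplus>\<^bsub>quotient_alg V U\<^esub> X = X"
      by (simp add: quotient_zero)
    have "(U +>\<^bsub>V\<^esub> (\<ominus>\<^bsub>V\<^esub> x)) \<oplus>\<^bsub>quotient_alg V U\<^esub> X = U"
      using quotient_add[OF U, of "\<ominus>\<^bsub>V\<^esub> x" x] x U0 by (simp add: M.l_neg)
    then show "\<exists>Y\<in>carrier (quotient_alg V U). Y \<oplus>\<^bsub>quotient_alg V U\<^esub> X = \<zero>\<^bsub>quotient_alg V U\<^esub>"
      using x unfolding quotient_zero quotient_carrier by blast
  qed (auto simp: q M.a_ac)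
  then have "module F (quotient_alg V U)"
  proof (rule moduleI[OF F.is_cring])
    show "a \<odot>\<^bsub>quotient_alg V U\<^esub> X \<in> carrier (quotient_alg V U)"
      if "a \<in> carrier F" "X \<in> carrier (quotient_alg V U)" for a X
      using that by (auto simp: q)
    show "(a \<oplus>\<^bsub>F\<^esub> b) \<odot>\<^bsub>quotient_alg V U\<^esub> X =
        a \<odot>\<^bsub>quotient_alg V U\<^esub> X \<oplus>\<^bsub>quotient_alg V U\<^esub> b \<odot>\<^bsub>quotient_alg V U\<^esub> X"
      if "a \<in> carrier F" "b \<in> carrier F" "X \<in> carrier (quotient_alg V U)" for a b X
      using that by (auto simp: q V.smult_l_distr)
    show "a \<odot>\<^bsub>quotient_alg V U\<^esub> (X \<oplus>\<^bsub>quotient_alg V U\<^esub> Y) =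
        a \<odot>\<^bsub>quotient_alg V U\<^esub> X \<oplus>\<^bsub>quotient_alg V U\<^esub> a \<odot>\<^bsub>quotient_alg V U\<^esub> Y"
      if "a \<in> carrier F" "X \<in> carrier (quotient_alg V U)" "Y \<in> carrier (quotient_alg V U)" for a X Y
      using that by (auto simp: q V.smult_r_distr)
    show "(a \<otimes>\<^bsub>F\<^esub> b) \<odot>\<^bsub>quotient_alg V U\<^esub> X =
        a \<odot>\<^bsub>quotient_alg V U\<^esub> (b \<odot>\<^bsub>quotient_alg V U\<^esub> X)"
      if "a \<in> carrier F" "b \<in> carrier F" "X \<in> carrier (quotient_alg V U)" for a b X
      using that by (auto simp: q V.smult_assoc1)
    show "\<one>\<^bsub>F\<^esub> \<odot>\<^bsub>quotient_alg V U\<^esub> X = X" if "X \<in> carrier (quotient_alg V U)" for X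
      using that by (auto simp: q)
  qed
  then show ?thesis
    by (intro field_module.intro F.field_axioms)
qed

text \<open>The projection maps the flag link by link, and no link collapses because every space of
  the flag contains \<open>U\<close>.\<close>

lemma reldim_quotient:
  assumes "reldim F V U X n" "sub U"
  shows "reldim F (quotient_alg V U) {U} ((\<lambda>x. U +>\<^bsub>V\<^esub> x) ` X) n"
  using assms
proof (induction rule: reldim.induct)
  case refl
  then have "(\<lambda>x. U +>\<^bsub>V\<^esub> x) ` U = {U}"
    using coset_eq_self_iff sub_zero sub_mem_carrier by blast
  then show ?case
    by (simp add: reldim.refl)
next
  case (step X n v)
  let ?q = "\<lambda>x. U +>\<^bsub>V\<^esub> x"
  have X: "sub X" "U \<subseteq> X"
    using step reldim_sub reldim_subset by blast+
  have "?q v \<notin> ?q ` X"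
  proof
    assume "?q v \<in> ?q ` X"
    then obtain x where x: "x \<in> X" "?q v = ?q x"
      by blast
    then obtain u where u: "u \<in> U" "v = u \<oplus>\<^bsub>V\<^esub> x"
      using coset_eq_iff[OF step(5,2)] sub_mem_carrier[OF X(1)] by blast
    then show False
      using sub_add[OF X(1)] x X(2) step(3) by blast
  qed
  moreover have "line_ext F (quotient_alg V U) (?q v) (?q ` X) = ?q ` ext v X"
  proof -
    have "?q (x \<oplus>\<^bsub>V\<^esub> a \<odot>\<^bsub>V\<^esub> v) = ?q x \<oplus>\<^bsub>quotient_alg V U\<^esub> a \<odot>\<^bsub>quotient_alg V U\<^esub> ?q v"
      if "x \<in> X" "a \<in> carrier F" for x a
      using that quotient_add[OF step(5)] quotient_smult[OF step(5)] sub_mem_carrier[OF X(1)] step(2)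
      by simp
    then show ?thesis
      unfolding line_ext_def by blast
  qed
  moreover have "?q v \<in> carrier (quotient_alg V U)"
    using step(2) by (auto simp: quotient_carrier)
  ultimately show ?case
    using reldim.step[of F "quotient_alg V U" "{U}" "?q ` X" n "?q v"] step by simp
qed

lemma vdim_quotient:
  assumes "reldim F V U (carrier V) n" "sub U"
  shows "vdim F (quotient_alg V U) = n"
proof -
  interpret Q: field_module F "quotient_alg V U"
    by (rule quotient_field_module[OF assms(2)])
  show ?thesis
    using Q.vdim_eqI reldim_quotient[OF assms] by (simp add: quotient_carrier quotient_zero)
qed

text \<open>This converts the dimensions of chief factors and of c-sections, which are quotients of
  restricted algebras, into lengths of flags in the ambient space.\<close>

lemma vdim_quotient_restrict:
  assumes "reldim F V U W n" "sub U"
  shows "vdim F (quotient_alg (V\<lparr>carrier := W\<rparr>) U) = n"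
proof -
  have W: "sub W" "U \<subseteq> W"
    using assms reldim_sub reldim_subset by blast+
  interpret W: field_module F "V\<lparr>carrier := W\<rparr>"
    by (rule restrict_field_module[OF W(1)])
  show ?thesis
    using W.vdim_quotient[of U n] reldim_restrict[OF assms subset_refl] restrict_submodule[OF assms(2) W]
    by simp
qed

lemma set_add_commute: "\<lbrakk>A \<subseteq> carrier V; B \<subseteq> carrier V\<rbrakk> \<Longrightarrow> A <+>\<^bsub>V\<^esub> B = B <+>\<^bsub>V\<^esub> A"
proof -
  assume A: "A \<subseteq> carrier V" and B: "B \<subseteq> carrier V"
  have "\<exists>b\<in>B. \<exists>a\<in>A. x \<oplus>\<^bsub>V\<^esub> y = b \<oplus>\<^bsub>V\<^esub> a" if "x \<in> A" "y \<in> B" for x y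
    using that M.a_comm[of x y] A B by blast
  moreover have "\<exists>a\<in>A. \<exists>b\<in>B. x \<oplus>\<^bsub>V\<^esub> y = a \<oplus>\<^bsub>V\<^esub> b" if "x \<in> B" "y \<in> A" for x y
    using that M.a_comm[of x y] A B by blast
  ultimately show ?thesis
    unfolding set_eq_iff mem_set_add by blast
qed

lemma mem_sub_of_coset_eq:
  assumes "sub U" "sub W" "U \<subseteq> W" "w \<in> W" "x \<in> carrier V" "U +>\<^bsub>V\<^esub> x = U +>\<^bsub>V\<^esub> w"
  shows "x \<in> W"
proof -
  obtain u where "u \<in> U" "x = u \<oplus>\<^bsub>V\<^esub> w"
    using coset_eq_iff[OF assms(1,5)] sub_mem_carrier[OF assms(2,4)] assms(6) by blast
  then show ?thesis
    using sub_add assms by blast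
qed

lemma sub_quotient_image:
  assumes U: "sub U" and W: "sub W"
  shows "submodule ((\<lambda>x. U +>\<^bsub>V\<^esub> x) ` W) F (quotient_alg V U)"
proof -
  interpret Q: field_module F "quotient_alg V U"
    by (rule quotient_field_module[OF U])
  let ?Q = "quotient_alg V U" and ?q = "\<lambda>x. U +>\<^bsub>V\<^esub> x"
  have smult: "a \<odot>\<^bsub>?Q\<^esub> X \<in> ?q ` W" if "a \<in> carrier F" "X \<in> ?q ` W" for a X
    using that quotient_smult[OF U] sub_mem_carrier[OF W] sub_smult[OF W] by auto
  have carr: "?q ` W \<subseteq> carrier ?Q"
    using sub_mem_carrier[OF W] by (auto simp: quotient_carrier)
  show ?thesis
  proof (rule Q.V.submoduleI[OF carr _ _ _ smult])
    have "?q \<zero>\<^bsub>V\<^esub> = U"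
      using coset_eq_self_iff[OF U] sub_zero[OF U] by simp
    then show "\<zero>\<^bsub>?Q\<^esub> \<in> ?q ` W"
      using sub_zero[OF W] unfolding quotient_zero by force
    show "\<ominus>\<^bsub>?Q\<^esub> X \<in> ?q ` W" if "X \<in> ?q ` W" for X
    proof -
      have X: "X \<in> carrier ?Q"
        using that carr by blast
      \<comment> \<open>Negation is rewritten as multiplication by -1, for which closure is already
        known.\<close>
      then have "(\<ominus>\<^bsub>F\<^esub> \<one>\<^bsub>F\<^esub>) \<odot>\<^bsub>?Q\<^esub> X = \<ominus>\<^bsub>?Q\<^esub> X"
        using Q.V.smult_l_minus[OF F.one_closed X] Q.V.smult_one[OF X] by simp
      then show ?thesis
        using smult[OF F.a_inv_closed[OF F.one_closed] that] by simp
    qed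
    show "X \<oplus>\<^bsub>?Q\<^esub> Y \<in> ?q ` W" if "X \<in> ?q ` W" "Y \<in> ?q ` W" for X Y
      using that quotient_add[OF U] sub_mem_carrier[OF W] sub_add[OF W] by auto
  qed
qed

lemma sub_quotient_preimage:
  assumes U: "sub U" and J: "submodule J F (quotient_alg V U)"
  shows "sub {x \<in> carrier V. U +>\<^bsub>V\<^esub> x \<in> J}"
proof -
  interpret Q: field_module F "quotient_alg V U"
    by (rule quotient_field_module[OF U])
  let ?q = "\<lambda>x. U +>\<^bsub>V\<^esub> x"
  have smult: "?q (a \<odot>\<^bsub>V\<^esub> x) \<in> J" if "a \<in> carrier F" "x \<in> carrier V" "?q x \<in> J" for a x
    using quotient_smult[OF U that(1,2)] Q.sub_smult[OF J that(1,3)] by simp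
  show ?thesis
  proof (rule V.submoduleI)
    have "?q \<zero>\<^bsub>V\<^esub> = U"
      using coset_eq_self_iff[OF U] sub_zero[OF U] by simp
    then show "\<zero>\<^bsub>V\<^esub> \<in> {x \<in> carrier V. ?q x \<in> J}"
      using Q.sub_zero[OF J] by (simp add: quotient_zero)
    show "\<ominus>\<^bsub>V\<^esub> x \<in> {x \<in> carrier V. ?q x \<in> J}" if "x \<in> {x \<in> carrier V. ?q x \<in> J}" for x
      using smult[OF F.a_inv_closed[OF F.one_closed], of x] V.smult_l_minus[OF F.one_closed, of x] that
      by simp
    show "x \<oplus>\<^bsub>V\<^esub> y \<in> {x \<in> carrier V. ?q x \<in> J}"
      if "x \<in> {x \<in> carrier V. ?q x \<in> J}" "y \<in> {x \<in> carrier V. ?q x \<in> J}" for x y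
      using that quotient_add[OF U, of x y] Q.sub_add[OF J] by force
  qed (use smult in auto)
qed

end

subsection \<open>Ideals and chief factors\<close>

sublocale lie_algebra \<subseteq> field_module F L
  by unfold_locales

context lie_algebra
begin

abbreviation ideal :: "'c set \<Rightarrow> bool" where
  "ideal I \<equiv> lie_ideal F L I"

section \<open>Brackets, sums of ideals, and the core\<close>

lemma ideal_sub: "ideal I \<Longrightarrow> sub I"
  by (simp add: lie_ideal_def)

lemma ideal_mem_carrier: "\<lbrakk>ideal I; x \<in> I\<rbrakk> \<Longrightarrow> x \<in> carrier L"
  using ideal_sub sub_mem_carrier by blast

lemma ideal_bracket_right: "\<lbrakk>ideal I; x \<in> carrier L; y \<in> I\<rbrakk> \<Longrightarrow> x \<otimes>\<^bsub>L\<^esub> y \<in> I"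
  by (simp add: lie_ideal_def)

text \<open>Polarisation: the bracket of \<open>x \<oplus> y\<close> with itself vanishes and is
  expanded.\<close>

lemma bracket_anticomm:
  assumes "x \<in> carrier L" "y \<in> carrier L"
  shows "x \<otimes>\<^bsub>L\<^esub> y = \<ominus>\<^bsub>L\<^esub> (y \<otimes>\<^bsub>L\<^esub> x)"
proof -
  have "(x \<oplus>\<^bsub>L\<^esub> y) \<otimes>\<^bsub>L\<^esub> (x \<oplus>\<^bsub>L\<^esub> y) = x \<otimes>\<^bsub>L\<^esub> y \<oplus>\<^bsub>L\<^esub> y \<otimes>\<^bsub>L\<^esub> x"
    using assms bracket_self[of x] bracket_self[of y]
    by (simp add: bracket_add_left bracket_add_right bracket_closed M.a_comm)
  then have "x \<otimes>\<^bsub>L\<^esub> y \<oplus>\<^bsub>L\<^esub> y \<otimes>\<^bsub>L\<^esub> x = \<zero>\<^bsub>L\<^esub>"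
    using assms bracket_self by simp
  then show ?thesis
    using assms bracket_closed M.minus_equality by (metis)
qed

lemma bracket_zero_right:
  assumes "x \<in> carrier L"
  shows "x \<otimes>\<^bsub>L\<^esub> \<zero>\<^bsub>L\<^esub> = \<zero>\<^bsub>L\<^esub>"
  using bracket_smult_right[of "\<zero>\<^bsub>F\<^esub>" x x] assms bracket_closed by simp

text \<open>\<open>lie_ideal\<close> asks for absorption on one side only; anticommutativity
  supplies the other.\<close>

lemma ideal_bracket_left:
  assumes "ideal I" "x \<in> I" "y \<in> carrier L"
  shows "x \<otimes>\<^bsub>L\<^esub> y \<in> I"
  using bracket_anticomm[OF ideal_mem_carrier[OF assms(1,2)] assms(3)]
    submoduleE(3)[OF ideal_sub[OF assms(1)] ideal_bracket_right[OF assms(1,3,2)]]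
  by simp

lemma ideal_zero: "ideal {\<zero>\<^bsub>L\<^esub>}"
  by (simp add: lie_ideal_def sub_zero_singleton bracket_zero_right)

lemma ideal_carrier: "ideal (carrier L)"
  by (simp add: lie_ideal_def carrier_is_submodule bracket_closed)

lemma ideal_Int: "\<lbrakk>ideal I; ideal J\<rbrakk> \<Longrightarrow> ideal (I \<inter> J)"
  by (simp add: lie_ideal_def sub_Int)

lemma ideal_set_add:
  assumes "ideal I" "ideal J"
  shows "ideal (I <+>\<^bsub>L\<^esub> J)"
proof -
  have "x \<otimes>\<^bsub>L\<^esub> y \<in> I <+>\<^bsub>L\<^esub> J" if x: "x \<in> carrier L" and y: "y \<in> I <+>\<^bsub>L\<^esub> J" for x y
  proof -
    obtain a b where y: "a \<in> I" "b \<in> J" "y = a \<oplus>\<^bsub>L\<^esub> b"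
      using y unfolding mem_set_add by blast
    then have "x \<otimes>\<^bsub>L\<^esub> y = x \<otimes>\<^bsub>L\<^esub> a \<oplus>\<^bsub>L\<^esub> x \<otimes>\<^bsub>L\<^esub> b"
      using x bracket_add_right ideal_mem_carrier[OF assms(1)] ideal_mem_carrier[OF assms(2)] by simp
    then show ?thesis
      using add_mem_set_add ideal_bracket_right[OF assms(1) x] ideal_bracket_right[OF assms(2) x] y
      by simp
  qed
  then show ?thesis
    using assms by (simp add: lie_ideal_def sub_set_add)
qed

lemma subalgebra_add_ideal:
  assumes B: "lie_subalgebra F L B" and I: "ideal I"
  shows "lie_subalgebra F L (B <+>\<^bsub>L\<^esub> I)"
proof -
  have sB: "sub B"
    using B by (simp add: lie_subalgebra_def)
  have "x \<otimes>\<^bsub>L\<^esub> y \<in> B <+>\<^bsub>L\<^esub> I" if xy: "x \<in> B <+>\<^bsub>L\<^esub> I" "y \<in> B <+>\<^bsub>L\<^esub> I" for x y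
  proof -
    obtain b i where x: "b \<in> B" "i \<in> I" "x = b \<oplus>\<^bsub>L\<^esub> i"
      using xy by (auto simp: mem_set_add)
    obtain c j where y: "c \<in> B" "j \<in> I" "y = c \<oplus>\<^bsub>L\<^esub> j"
      using xy by (auto simp: mem_set_add)
    have car: "b \<in> carrier L" "i \<in> carrier L" "c \<in> carrier L" "j \<in> carrier L"
      using x y sub_mem_carrier[OF sB] ideal_mem_carrier[OF I] by auto
    \<comment> \<open>All terms involving \<open>i\<close> or \<open>j\<close> are collected into
      the ideal part.\<close>
    have "x \<otimes>\<^bsub>L\<^esub> y = b \<otimes>\<^bsub>L\<^esub> c \<oplus>\<^bsub>L\<^esub> (b \<otimes>\<^bsub>L\<^esub> j \<oplus>\<^bsub>L\<^esub> i \<otimes>\<^bsub>L\<^esub> y)"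
      using x y car by (simp add: bracket_add_left bracket_add_right bracket_closed M.a_ac)
    moreover have "b \<otimes>\<^bsub>L\<^esub> c \<in> B"
      using x y B by (simp add: lie_subalgebra_def)
    moreover have "b \<otimes>\<^bsub>L\<^esub> j \<oplus>\<^bsub>L\<^esub> i \<otimes>\<^bsub>L\<^esub> y \<in> I"
      using x y car by (intro sub_add ideal_sub[OF I] ideal_bracket_left[OF I] ideal_bracket_right[OF I]) auto
    ultimately show ?thesis
      using add_mem_set_add by simp
  qed
  then show ?thesis
    using sB sub_set_add ideal_sub[OF I] by (simp add: lie_subalgebra_def)
qed

text \<open>The sum of two ideals inside \<open>B\<close> is again an ideal inside \<open>B\<close>,
  so the union of all such ideals is closed under addition and is the greatest one. This gives
  meaning to \<open>GREATEST\<close> in \<open>lie_core\<close>.\<close>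

lemma lie_core_greatest:
  assumes B: "sub B"
  shows "ideal (lie_core F L B)" "lie_core F L B \<subseteq> B"
    "\<And>I. \<lbrakk>ideal I; I \<subseteq> B\<rbrakk> \<Longrightarrow> I \<subseteq> lie_core F L B"
proof -
  define K where "K = \<Union>{I. ideal I \<and> I \<subseteq> B}"
  have mem: "x \<in> K \<longleftrightarrow> (\<exists>I. ideal I \<and> I \<subseteq> B \<and> x \<in> I)" for x
    by (auto simp: K_def)
  have "sub K"
  proof (rule submoduleI)
    show "K \<subseteq> carrier L"
      using mem ideal_mem_carrier by blast
    show "\<zero>\<^bsub>L\<^esub> \<in> K"
      using mem ideal_zero sub_zero[OF B] by blast
    show "\<ominus>\<^bsub>L\<^esub> x \<in> K" if "x \<in> K" for x
      using that mem ideal_sub submoduleE(3) by metis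
    show "a \<odot>\<^bsub>L\<^esub> x \<in> K" if "a \<in> carrier F" "x \<in> K" for a x
      using that mem ideal_sub sub_smult by metis
    show "x \<oplus>\<^bsub>L\<^esub> y \<in> K" if "x \<in> K" "y \<in> K" for x y
    proof -
      obtain I J where "ideal I" "I \<subseteq> B" "x \<in> I" "ideal J" "J \<subseteq> B" "y \<in> J"
        using \<open>x \<in> K\<close> \<open>y \<in> K\<close> mem by blast
      then have "ideal (I <+>\<^bsub>L\<^esub> J)" "I <+>\<^bsub>L\<^esub> J \<subseteq> B" "x \<oplus>\<^bsub>L\<^esub> y \<in> I <+>\<^bsub>L\<^esub> J"
        by (simp_all add: ideal_set_add set_add_least B add_mem_set_add)
      then show ?thesis
        using mem by blast
    qed
  qed
  moreover have "x \<otimes>\<^bsub>L\<^esub> y \<in> K" if "x \<in> carrier L" "y \<in> K" for x y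
    using that mem ideal_bracket_right by blast
  ultimately have K: "ideal K \<and> K \<subseteq> B"
    using K_def by (auto simp: lie_ideal_def)
  have "lie_core F L B = K"
    unfolding lie_core_def
  proof (rule Greatest_equality)
    show "ideal K \<and> K \<subseteq> B"
      by (rule K)
    show "I \<subseteq> K" if "ideal I \<and> I \<subseteq> B" for I
      using that mem by blast
  qed
  then show "ideal (lie_core F L B)" "lie_core F L B \<subseteq> B"
    "\<And>I. \<lbrakk>ideal I; I \<subseteq> B\<rbrakk> \<Longrightarrow> I \<subseteq> lie_core F L B"
    using K by (auto simp: K_def)
qed

section \<open>The quotient by an ideal and the correspondence of ideals\<close>

lemma quotient_bracket:
  assumes D: "ideal D" and x: "x \<in> carrier L" and y: "y \<in> carrier L"
  shows "(D +>\<^bsub>L\<^esub> x) \<otimes>\<^bsub>quotient_alg L D\<^esub> (D +>\<^bsub>L\<^esub> y) = D +>\<^bsub>L\<^esub> (x \<otimes>\<^bsub>L\<^esub> y)"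
proof -
  interpret D: abelian_subgroup D L
    by (rule sub_abelian_subgroup[OF ideal_sub[OF D]])
  have "D +>\<^bsub>L\<^esub> (x' \<otimes>\<^bsub>L\<^esub> y') = D +>\<^bsub>L\<^esub> (x \<otimes>\<^bsub>L\<^esub> y)"
    if x': "x' \<in> D +>\<^bsub>L\<^esub> x" and y': "y' \<in> D +>\<^bsub>L\<^esub> y" for x' y'
  proof -
    obtain d where d: "d \<in> D" "x' = d \<oplus>\<^bsub>L\<^esub> x"
      using x' by (auto simp: a_r_coset_def')
    obtain e where e: "e \<in> D" "y' = e \<oplus>\<^bsub>L\<^esub> y"
      using y' by (auto simp: a_r_coset_def')
    have car: "d \<in> carrier L" "e \<in> carrier L" "x' \<in> carrier L" "y' \<in> carrier L"
      using d e x y ideal_mem_carrier[OF D] by auto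
    \<comment> \<open>Changing the representatives changes the bracket only by terms containing
      \<open>d\<close> or \<open>e\<close>, which lie in \<open>D\<close>.\<close>
    have "x' \<otimes>\<^bsub>L\<^esub> y' = (d \<otimes>\<^bsub>L\<^esub> y' \<oplus>\<^bsub>L\<^esub> x \<otimes>\<^bsub>L\<^esub> e) \<oplus>\<^bsub>L\<^esub> x \<otimes>\<^bsub>L\<^esub> y"
      using d e x y car by (simp add: bracket_add_left bracket_add_right bracket_closed M.a_ac)
    moreover have "d \<otimes>\<^bsub>L\<^esub> y' \<oplus>\<^bsub>L\<^esub> x \<otimes>\<^bsub>L\<^esub> e \<in> D"
      using d e x car by (intro sub_add ideal_sub[OF D] ideal_bracket_left[OF D] ideal_bracket_right[OF D]) auto
    ultimately show ?thesis
      using coset_eq_iff[OF ideal_sub[OF D]] car x y bracket_closed by blast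
  qed
  then have "(\<Union>x'\<in>D +>\<^bsub>L\<^esub> x. \<Union>y'\<in>D +>\<^bsub>L\<^esub> y. D +>\<^bsub>L\<^esub> (x' \<otimes>\<^bsub>L\<^esub> y')) = D +>\<^bsub>L\<^esub> (x \<otimes>\<^bsub>L\<^esub> y)"
    using D.a_rcos_self[OF x] D.a_rcos_self[OF y] by blast
  then show ?thesis
    by (simp add: quotient_alg_def ring.defs FactRing_def rcoset_mult_def)
qed

lemma ideal_quotient_image:
  assumes "ideal D" "ideal E"
  shows "lie_ideal F (quotient_alg L D) ((\<lambda>x. D +>\<^bsub>L\<^esub> x) ` E)"
  unfolding lie_ideal_def
proof (intro conjI ballI)
  show "submodule ((\<lambda>x. D +>\<^bsub>L\<^esub> x) ` E) F (quotient_alg L D)"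
    using sub_quotient_image assms ideal_sub by blast
  fix X Y assume "X \<in> carrier (quotient_alg L D)" "Y \<in> (\<lambda>x. D +>\<^bsub>L\<^esub> x) ` E"
  then obtain x y where x: "x \<in> carrier L" "X = D +>\<^bsub>L\<^esub> x" and y: "y \<in> E" "Y = D +>\<^bsub>L\<^esub> y"
    by (auto simp: quotient_carrier)
  then have "X \<otimes>\<^bsub>quotient_alg L D\<^esub> Y = D +>\<^bsub>L\<^esub> (x \<otimes>\<^bsub>L\<^esub> y)"
    using quotient_bracket[OF assms(1)] ideal_mem_carrier[OF assms(2)] by simp
  then show "X \<otimes>\<^bsub>quotient_alg L D\<^esub> Y \<in> (\<lambda>x. D +>\<^bsub>L\<^esub> x) ` E"
    using ideal_bracket_right[OF assms(2)] x y by simp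
qed

lemma ideal_quotient_preimage:
  assumes D: "ideal D" and J: "lie_ideal F (quotient_alg L D) J"
  shows "ideal {x \<in> carrier L. D +>\<^bsub>L\<^esub> x \<in> J}"
  unfolding lie_ideal_def
proof (intro conjI ballI)
  show "sub {x \<in> carrier L. D +>\<^bsub>L\<^esub> x \<in> J}"
    using sub_quotient_preimage ideal_sub[OF D] J by (simp add: lie_ideal_def)
  fix x y assume x: "x \<in> carrier L" and y: "y \<in> {x \<in> carrier L. D +>\<^bsub>L\<^esub> x \<in> J}"
  then have "(D +>\<^bsub>L\<^esub> x) \<otimes>\<^bsub>quotient_alg L D\<^esub> (D +>\<^bsub>L\<^esub> y) \<in> J"
    using J by (auto simp: lie_ideal_def quotient_carrier)
  then show "x \<otimes>\<^bsub>L\<^esub> y \<in> {x \<in> carrier L. D +>\<^bsub>L\<^esub> x \<in> J}"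
    using quotient_bracket[OF D x] x y bracket_closed by simp
qed

text \<open>By the correspondence of ideals, minimality of \<open>C/D\<close> in the quotient says
  that no ideal lies strictly between \<open>D\<close> and \<open>C\<close>. Later arguments use
  this form and stay inside \<open>L\<close>.\<close>

lemma chief_factor_iff:
  "chief_factor F L C D \<longleftrightarrow> ideal C \<and> ideal D \<and> D \<subset> C \<and>
    (\<forall>E. ideal E \<and> D \<subseteq> E \<and> E \<subseteq> C \<longrightarrow> E = D \<or> E = C)"
proof -
  let ?Q = "quotient_alg L D" and ?q = "\<lambda>x. D +>\<^bsub>L\<^esub> x"
  have "minimal_lie_ideal F ?Q (?q ` C) \<longleftrightarrow> (\<forall>E. ideal E \<and> D \<subseteq> E \<and> E \<subseteq> C \<longrightarrow> E = D \<or> E = C)"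
    if C: "ideal C" and D: "ideal D" and DC: "D \<subset> C"
  proof
    assume min: "minimal_lie_ideal F ?Q (?q ` C)"
    have "E = C" if E: "ideal E" "D \<subseteq> E" "E \<subseteq> C" "E \<noteq> D" for E
    proof -
      obtain e where e: "e \<in> E" "e \<notin> D"
        using E by blast
      then have "?q e \<noteq> D"
        using coset_eq_self_iff[OF ideal_sub[OF D]] ideal_mem_carrier[OF E(1)] by blast
      then have "?q ` E \<noteq> {D}"
        using e by blast
      moreover have "?q ` E \<subseteq> ?q ` C"
        using E(3) by blast
      ultimately have "?q ` E = ?q ` C"
        using min ideal_quotient_image[OF D E(1)]
        unfolding minimal_lie_ideal_def quotient_zero by simp
      have "c \<in> E" if c: "c \<in> C" for c
      proof -
        have "?q c \<in> ?q ` E"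
          using c \<open>?q ` E = ?q ` C\<close> by blast
        then obtain e where "e \<in> E" "?q c = ?q e"
          by blast
        then show ?thesis
          using mem_sub_of_coset_eq[OF ideal_sub[OF D] ideal_sub[OF E(1)] E(2)]
            ideal_mem_carrier[OF C c] by blast
      qed
      then show ?thesis
        using E by blast
    qed
    then show "\<forall>E. ideal E \<and> D \<subseteq> E \<and> E \<subseteq> C \<longrightarrow> E = D \<or> E = C"
      by blast
  next
    assume max: "\<forall>E. ideal E \<and> D \<subseteq> E \<and> E \<subseteq> C \<longrightarrow> E = D \<or> E = C"
    obtain c where c: "c \<in> C" "c \<notin> D"
      using DC by blast
    then have "?q c \<noteq> D"
      using coset_eq_self_iff[OF ideal_sub[OF D]] ideal_mem_carrier[OF C] by blast
    then have ne: "?q ` C \<noteq> {D}"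
      using c by blast
    have "J = ?q ` C" if J: "lie_ideal F ?Q J" "J \<subseteq> ?q ` C" "J \<noteq> {D}" for J
    proof -
      interpret Q: field_module F ?Q
        by (rule quotient_field_module[OF ideal_sub[OF D]])
      \<comment> \<open>The full preimage of \<open>J\<close> is an ideal between \<open>D\<close>
        and \<open>C\<close> other than \<open>D\<close>, to which \<open>max\<close>
        applies.\<close>
      let ?E = "{x \<in> carrier L. ?q x \<in> J}"
      have DJ: "D \<in> J"
        using J(1) Q.sub_zero unfolding lie_ideal_def quotient_zero by blast
      have E: "ideal ?E"
        by (rule ideal_quotient_preimage[OF D J(1)])
      have "D \<subseteq> ?E"
      proof
        fix x assume x: "x \<in> D"
        then have "x \<in> carrier L" "?q x = D"
          using coset_eq_self_iff[OF ideal_sub[OF D]] ideal_mem_carrier[OF D] by blast+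
        then show "x \<in> ?E"
          using DJ by simp
      qed
      moreover have "?E \<subseteq> C"
      proof
        fix x assume x: "x \<in> ?E"
        then obtain c where "c \<in> C" "?q x = ?q c"
          using J(2) by blast
        then show "x \<in> C"
          using x DC mem_sub_of_coset_eq[OF ideal_sub[OF D] ideal_sub[OF C]] by blast
      qed
      moreover have "?E \<noteq> D"
      proof -
        obtain X where X: "X \<in> J" "X \<noteq> D"
          using J(3) DJ by blast
        then obtain x where x: "x \<in> C" "X = ?q x"
          using J(2) by blast
        then have "x \<in> ?E" "x \<notin> D"
          using X coset_eq_self_iff[OF ideal_sub[OF D]] ideal_mem_carrier[OF C] by auto
        then show ?thesis
          by blast
      qed
      ultimately have "?E = C"
        using max E by blast
      then show ?thesis
        using J(2) by blast
    qed
    then show "minimal_lie_ideal F ?Q (?q ` C)"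
      unfolding minimal_lie_ideal_def quotient_zero using ideal_quotient_image[OF D C] ne by blast
  qed
  then show ?thesis
    unfolding chief_factor_def quotient_carrier_restrict by blast
qed

end

subsection \<open>Maximal subalgebras\<close>

locale lie_algebra_maximal = lie_algebra +
  fixes M
  assumes fin_dim: "finite_dimensional F L"
    and maximal: "maximal_lie_subalgebra F L M"
begin

abbreviation K :: "'c set" where
  "K \<equiv> lie_core F L M"

text \<open>These are the pairs that define c-sections of \<open>M\<close>. Keeping the pair instead
  of the quotient retains both \<open>(M \<inter> C)/D\<close> and \<open>C/D\<close>.\<close>

definition section_factor :: "'c set \<Rightarrow> 'c set \<Rightarrow> bool" where
  "section_factor C D \<longleftrightarrow> chief_factor F L C D \<and> D \<subseteq> M \<and> carrier L = M <+>\<^bsub>L\<^esub> C"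

section \<open>The core of \<open>M\<close> and the supplements of \<open>M\<close>\<close>

lemma M_sub: "sub M"
  using maximal by (simp add: maximal_lie_subalgebra_def lie_subalgebra_def)

lemma M_bracket: "\<lbrakk>x \<in> M; y \<in> M\<rbrakk> \<Longrightarrow> x \<otimes>\<^bsub>L\<^esub> y \<in> M"
  using maximal by (simp add: maximal_lie_subalgebra_def lie_subalgebra_def)

lemmas K_ideal = lie_core_greatest(1)[OF M_sub]
  and K_subset = lie_core_greatest(2)[OF M_sub]
  and K_greatest = lie_core_greatest(3)[OF M_sub]

text \<open>The sum of \<open>M\<close> and \<open>I\<close> is a subalgebra containing
  \<open>M\<close>, so by maximality it is \<open>M\<close> or all of \<open>L\<close>.
  Supplementing thus becomes a mere failure of inclusion.\<close>

lemma supplement_iff: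
  assumes "ideal I"
  shows "carrier L = M <+>\<^bsub>L\<^esub> I \<longleftrightarrow> \<not> I \<subseteq> M"
proof
  assume eq: "carrier L = M <+>\<^bsub>L\<^esub> I"
  show "\<not> I \<subseteq> M"
  proof
    assume "I \<subseteq> M"
    then have "carrier L \<subseteq> M"
      unfolding eq by (intro set_add_least M_sub subset_refl)
    then show False
      using maximal submoduleE(1)[OF M_sub] by (auto simp: maximal_lie_subalgebra_def)
  qed
next
  assume not: "\<not> I \<subseteq> M"
  have "lie_subalgebra F L (M <+>\<^bsub>L\<^esub> I)"
    using maximal subalgebra_add_ideal assms by (simp add: maximal_lie_subalgebra_def)
  moreover have "M \<subseteq> M <+>\<^bsub>L\<^esub> I" "I \<subseteq> M <+>\<^bsub>L\<^esub> I"
    using subset_set_add_left[OF submoduleE(1)[OF M_sub] ideal_sub[OF assms]]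
      subset_set_add_right[OF M_sub submoduleE(1)[OF ideal_sub[OF assms]]] by simp_all
  ultimately show "carrier L = M <+>\<^bsub>L\<^esub> I"
    using maximal not unfolding maximal_lie_subalgebra_def by metis
qed

lemma section_factorD:
  assumes "section_factor C D"
  shows "ideal C" "ideal D" "D \<subseteq> C" "D \<subseteq> M" "\<not> C \<subseteq> M"
    "\<And>E. \<lbrakk>ideal E; D \<subseteq> E; E \<subseteq> C\<rbrakk> \<Longrightarrow> E = D \<or> E = C"
proof -
  have "chief_factor F L C D" "D \<subseteq> M" "carrier L = M <+>\<^bsub>L\<^esub> C"
    using assms by (simp_all add: section_factor_def)
  then have CD: "ideal C \<and> ideal D \<and> D \<subset> C \<and>
      (\<forall>E. ideal E \<and> D \<subseteq> E \<and> E \<subseteq> C \<longrightarrow> E = D \<or> E = C)"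
    by (simp add: chief_factor_iff)
  then show "ideal C" "ideal D" "D \<subseteq> C" "\<And>E. \<lbrakk>ideal E; D \<subseteq> E; E \<subseteq> C\<rbrakk> \<Longrightarrow> E = D \<or> E = C"
    by (simp_all add: psubset_imp_subset)
  show "D \<subseteq> M"
    by fact
  show "\<not> C \<subseteq> M"
    using \<open>carrier L = M <+>\<^bsub>L\<^esub> C\<close> CD supplement_iff[of C] by simp
qed

text \<open>\<open>K \<inter> C\<close> is an ideal between \<open>D\<close> and \<open>C\<close>,
  and it is not \<open>C\<close> because \<open>C\<close> is not inside \<open>M\<close>.\<close>

lemma section_factor_core:
  assumes "section_factor C D"
  shows "K \<inter> C = D"
proof -
  note CD = section_factorD[OF assms]
  have "D \<subseteq> K \<inter> C"
    using CD K_greatest by blast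
  moreover have "K \<inter> C \<noteq> C"
    using CD K_subset by blast
  ultimately show ?thesis
    using CD ideal_Int[OF K_ideal] by blast
qed

text \<open>If \<open>E\<close> does not contain \<open>C\<close>, then \<open>[C, E] \<subseteq> D\<close>; as \<open>L = M + E\<close>, this makes \<open>M \<inter> C\<close> an ideal.\<close>
lemma section_factor_dichotomy:
  assumes CD: "section_factor C D" and E: "ideal E" "K \<subseteq> E" "\<not> E \<subseteq> M"
  shows "C \<subseteq> E \<or> M \<inter> C = D"
proof (rule disjCI)
  note CDs = section_factorD[OF CD]
  note core = section_factor_core[OF CD]
  assume "M \<inter> C \<noteq> D"
  show "C \<subseteq> E"
  proof (rule ccontr)
    assume "\<not> C \<subseteq> E"
    \<comment> \<open>Since \<open>D = K \<inter> C\<close> is contained in \<open>E\<close>, this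
      intersection is an ideal between \<open>D\<close> and \<open>C\<close>, and it is not
      \<open>C\<close>.\<close>
    then have CE: "C \<inter> E = D"
      using CDs(6)[OF ideal_Int[OF CDs(1) E(1)]] E(2) core by blast
    have "x \<otimes>\<^bsub>L\<^esub> y \<in> M \<inter> C" if x: "x \<in> carrier L" and y: "y \<in> M \<inter> C" for x y
    proof -
      obtain m e where me: "m \<in> M" "e \<in> E" "x = m \<oplus>\<^bsub>L\<^esub> e"
        using supplement_iff[OF E(1)] E(3) x mem_set_add by blast
      have car: "m \<in> carrier L" "e \<in> carrier L" "y \<in> carrier L"
        using me y sub_mem_carrier[OF M_sub] ideal_mem_carrier[OF E(1)] by auto
      have "m \<otimes>\<^bsub>L\<^esub> y \<in> M \<inter> C"
        using me y car M_bracket ideal_bracket_right[OF CDs(1)] by blast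
      \<comment> \<open>The bracket lies in \<open>C \<inter> E = D\<close>, which is inside
        \<open>M\<close>.\<close>
      moreover have "e \<otimes>\<^bsub>L\<^esub> y \<in> M \<inter> C"
        using me y car ideal_bracket_right[OF CDs(1)] ideal_bracket_left[OF E(1)] CE CDs(4) by blast
      ultimately show ?thesis
        using sub_add[OF sub_Int[OF M_sub ideal_sub[OF CDs(1)]]] me car by (simp add: bracket_add_left)
    qed
    then have "ideal (M \<inter> C)"
      using sub_Int[OF M_sub ideal_sub[OF CDs(1)]] unfolding lie_ideal_def by blast
    then have "M \<inter> C \<subseteq> K"
      using K_greatest by blast
    then show False
      using \<open>M \<inter> C \<noteq> D\<close> core CDs by blast
  qed
qed

text \<open>The modular law: as \<open>K \<subseteq> M\<close>, this intersection is the sum of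
  \<open>K\<close> and \<open>M \<inter> C\<close>.\<close>

lemma core_modular:
  assumes "ideal C" "M \<inter> C \<subseteq> K"
  shows "M \<inter> (K <+>\<^bsub>L\<^esub> C) \<subseteq> K"
proof
  fix m assume m: "m \<in> M \<inter> (K <+>\<^bsub>L\<^esub> C)"
  then obtain k c where kc: "k \<in> K" "c \<in> C" "m = k \<oplus>\<^bsub>L\<^esub> c"
    by (auto simp: mem_set_add)
  then have "c \<in> M"
    using sub_add_cancel[OF M_sub, of k c] m K_subset ideal_mem_carrier[OF assms(1)] by blast
  then show "m \<in> K"
    using kc assms(2) sub_add[OF ideal_sub[OF K_ideal]] by blast
qed

section \<open>Comparison of two chief factors\<close>

lemma subset_core_add:
  assumes "ideal C"
  shows "K \<subseteq> K <+>\<^bsub>L\<^esub> C" "C \<subseteq> K <+>\<^bsub>L\<^esub> C"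
  using subset_set_add_left[OF submoduleE(1)[OF ideal_sub[OF K_ideal]] ideal_sub[OF assms]]
    subset_set_add_right[OF ideal_sub[OF K_ideal] submoduleE(1)[OF ideal_sub[OF assms]]]
  by simp_all

text \<open>If \<open>C\<close> is not inside the sum of \<open>K\<close> and \<open>C'\<close>, the
  dichotomy applies to \<open>C\<close> directly. Otherwise it applies to \<open>C'\<close> and
  gives \<open>M \<inter> C' = D' \<subseteq> K\<close>, which the modular law carries over to
  \<open>C\<close>.\<close>

lemma section_trivial_if_not_subset:
  assumes CD: "section_factor C D" and CD': "section_factor C' D'"
    and not: "\<not> C \<subseteq> K <+>\<^bsub>L\<^esub> C' \<or> \<not> C' \<subseteq> K <+>\<^bsub>L\<^esub> C"
  shows "M \<inter> C = D"
proof (cases "C \<subseteq> K <+>\<^bsub>L\<^esub> C'")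
  case False
  have "ideal (K <+>\<^bsub>L\<^esub> C')" "\<not> K <+>\<^bsub>L\<^esub> C' \<subseteq> M"
    using ideal_set_add[OF K_ideal] subset_core_add section_factorD[OF CD'] by blast+
  then show ?thesis
    using section_factor_dichotomy[OF CD] subset_core_add(1)[OF section_factorD(1)[OF CD']] False by blast
next
  case True
  have "ideal (K <+>\<^bsub>L\<^esub> C)" "\<not> K <+>\<^bsub>L\<^esub> C \<subseteq> M"
    using ideal_set_add[OF K_ideal] subset_core_add section_factorD[OF CD] by blast+
  then have "M \<inter> C' = D'"
    using section_factor_dichotomy[OF CD'] subset_core_add(1)[OF section_factorD(1)[OF CD]] not True by blast
  then have "M \<inter> C' \<subseteq> K"
    using section_factorD[OF CD'] K_greatest by blast
  then have "M \<inter> C \<subseteq> K \<inter> C"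
    using core_modular[OF section_factorD(1)[OF CD']] True by blast
  then show ?thesis
    using section_factor_core[OF CD] K_subset by blast
qed

text \<open>The second isomorphism theorem for \<open>C\<close> and \<open>M\<close>, whose sum is
  \<open>L\<close>.\<close>

lemma reldim_supplement:
  assumes "ideal C" "\<not> C \<subseteq> M" "reldim F L (M \<inter> C) C n"
  shows "reldim F L M (carrier L) n"
proof -
  have "carrier L = C <+>\<^bsub>L\<^esub> M"
    using supplement_iff[OF assms(1)] assms(2) set_add_commute[of M C] submoduleE(1) M_sub ideal_sub[OF assms(1)]
    by blast
  then show ?thesis
    using reldim_second_iso[OF assms(3) sub_Int[OF M_sub ideal_sub[OF assms(1)]] M_sub] by auto
qed

lemma section_factor_reldim_unique:
  assumes CD: "section_factor C D" and CD': "section_factor C' D'"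
    and n: "reldim F L D C n" and n': "reldim F L D' C' n'"
  shows "n = n'"
proof (cases "C \<subseteq> K <+>\<^bsub>L\<^esub> C' \<and> C' \<subseteq> K <+>\<^bsub>L\<^esub> C")
  case True
  note CDs = section_factorD[OF CD] and CDs' = section_factorD[OF CD']
  have eq: "C <+>\<^bsub>L\<^esub> K = C' <+>\<^bsub>L\<^esub> K"
  proof -
    have "K <+>\<^bsub>L\<^esub> C = K <+>\<^bsub>L\<^esub> C'"
    proof
      show "K <+>\<^bsub>L\<^esub> C \<subseteq> K <+>\<^bsub>L\<^esub> C'"
        by (rule set_add_least[OF subset_core_add(1)[OF CDs'(1)] _ ideal_sub[OF ideal_set_add[OF K_ideal CDs'(1)]]])
          (use True in blast)
      show "K <+>\<^bsub>L\<^esub> C' \<subseteq> K <+>\<^bsub>L\<^esub> C"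
        by (rule set_add_least[OF subset_core_add(1)[OF CDs(1)] _ ideal_sub[OF ideal_set_add[OF K_ideal CDs(1)]]])
          (use True in blast)
    qed
    then show ?thesis
      using set_add_commute[of K C] set_add_commute[of K C'] submoduleE(1)[OF ideal_sub]
        K_ideal CDs(1) CDs'(1) by simp
  qed
  \<comment> \<open>As \<open>D = K \<inter> C\<close>, the flag moves above the core, where both
    factors end in the same sum.\<close>
  have 1: "reldim F L K (C <+>\<^bsub>L\<^esub> K) n"
    using reldim_second_iso[OF n ideal_sub[OF CDs(2)] ideal_sub[OF K_ideal]] section_factor_core[OF CD]
    by blast
  have "reldim F L K (C' <+>\<^bsub>L\<^esub> K) n'"
    using reldim_second_iso[OF n' ideal_sub[OF CDs'(2)] ideal_sub[OF K_ideal]] section_factor_core[OF CD']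
    by blast
  then show ?thesis
    using reldim_unique[OF 1 _ ideal_sub[OF K_ideal]] eq by simp
next
  case False
  have "M \<inter> C = D" "M \<inter> C' = D'"
    using section_trivial_if_not_subset[OF CD CD'] section_trivial_if_not_subset[OF CD' CD] False by blast+
  \<comment> \<open>Both flags start at the intersection with \<open>M\<close>, so both lengths are
    the codimension of \<open>M\<close>.\<close>
  then have "reldim F L M (carrier L) n" "reldim F L M (carrier L) n'"
    using reldim_supplement section_factorD[OF CD] section_factorD[OF CD'] n n' by simp_all
  then show ?thesis
    using reldim_unique M_sub by blast
qed

section \<open>Existence of minimal supplements and of chief factors\<close>

lemma ex_reldim: "\<lbrakk>sub U; sub W; U \<subseteq> W\<rbrakk> \<Longrightarrow> \<exists>n. reldim F L U W n"
  by (rule finite_dimensional_reldim[OF fin_dim])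

lemma reldim_zeroD: "reldim F L U W 0 \<Longrightarrow> W = U"
  by (cases rule: reldim.cases) auto

text \<open>An ideal of least dimension among those not inside \<open>M\<close> is taken; a
  supplement inside it has the same dimension and so is equal to it.\<close>

lemma ex_minimal_supplement: "\<exists>C. minimal_supplement F L M C"
proof -
  define P where "P n \<longleftrightarrow> (\<exists>C. ideal C \<and> \<not> C \<subseteq> M \<and> reldim F L {\<zero>\<^bsub>L\<^esub>} C n)" for n
  have z: "{\<zero>\<^bsub>L\<^esub>} \<subseteq> I" if "ideal I" for I
    using sub_zero ideal_sub that by blast
  have "\<not> carrier L \<subseteq> M"
    using maximal submoduleE(1)[OF M_sub] by (auto simp: maximal_lie_subalgebra_def)
  then obtain n0 where "P n0"
    using ex_reldim[OF sub_zero_singleton carrier_is_submodule] ideal_carrier z unfolding P_def by blast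
  then obtain n where n: "P n" "\<And>k. k < n \<Longrightarrow> \<not> P k"
    using exists_least_iff[of P] by blast
  then obtain C where C: "ideal C" "\<not> C \<subseteq> M" "reldim F L {\<zero>\<^bsub>L\<^esub>} C n"
    unfolding P_def by blast
  have "C' = C" if C': "ideal C'" "\<not> C' \<subseteq> M" "C' \<subseteq> C" for C'
  proof -
    obtain k where k: "k \<le> n" "reldim F L {\<zero>\<^bsub>L\<^esub>} C' k" "reldim F L C' C (n - k)"
      using reldim_split[OF C(3) sub_zero_singleton ideal_sub[OF C'(1)] z[OF C'(1)] C'(3)] by blast
    then have "P k"
      using C' unfolding P_def by blast
    then have "n - k = 0"
      using n(2)[of k] by fastforce
    then show ?thesis
      using k(3) reldim_zeroD by auto
  qed
  then have "\<forall>C'. ideal C' \<and> carrier L = M <+>\<^bsub>L\<^esub> C' \<and> C' \<subseteq> C \<longrightarrow> C' = C"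
    using supplement_iff by metis
  then have "minimal_supplement F L M C"
    unfolding minimal_supplement_def using C(1,2) supplement_iff[OF C(1)] by simp
  then show ?thesis
    by blast
qed

text \<open>\<open>D\<close> is an ideal properly inside \<open>C\<close> of least codimension in
  \<open>C\<close>; the zero ideal shows that there are candidates.\<close>

lemma ex_chief_factor:
  assumes C: "ideal C" "C \<noteq> {\<zero>\<^bsub>L\<^esub>}"
  shows "\<exists>D. chief_factor F L C D"
proof -
  define P where "P n \<longleftrightarrow> (\<exists>D. ideal D \<and> D \<subset> C \<and> reldim F L D C n)" for n
  have "{\<zero>\<^bsub>L\<^esub>} \<subset> C"
    using sub_zero ideal_sub C by blast
  then obtain n0 where "P n0"
    using ex_reldim[OF sub_zero_singleton ideal_sub[OF C(1)]] ideal_zero unfolding P_def by blast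
  then obtain n where n: "P n" "\<And>k. k < n \<Longrightarrow> \<not> P k"
    using exists_least_iff[of P] by blast
  then obtain D where D: "ideal D" "D \<subset> C" "reldim F L D C n"
    unfolding P_def by blast
  have "E = D \<or> E = C" if E: "ideal E" "D \<subseteq> E" "E \<subseteq> C" for E
  proof (cases "E = C")
    case False
    obtain k where k: "k \<le> n" "reldim F L D E k" "reldim F L E C (n - k)"
      using reldim_split[OF D(3) ideal_sub[OF D(1)] ideal_sub[OF E(1)] E(2,3)] by blast
    \<comment> \<open>An intermediate ideal \<open>E\<close> has codimension \<open>n - k\<close> in
      \<open>C\<close>, so leastness of \<open>n\<close> forces \<open>k = 0\<close>.\<close>
    then have "P (n - k)"
      using E False unfolding P_def by blast
    then have "k = 0"
      using n(2)[of "n - k"] k(1) by (cases k) auto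
    then show ?thesis
      using k(2) reldim_zeroD by auto
  qed simp
  then have "chief_factor F L C D"
    unfolding chief_factor_iff using C(1) D(1,2) by simp
  then show ?thesis
    by blast
qed

section \<open>The ideal index, the chosen c-section, and c-ideals\<close>

lemma minimal_supplement_section_factor:
  assumes "minimal_supplement F L M C" "chief_factor F L C D"
  shows "section_factor C D"
proof -
  have D: "ideal D" "D \<subset> C"
    using assms(2) chief_factor_iff by blast+
  \<comment> \<open>A proper subideal of a minimal supplement does not supplement \<open>M\<close>,
    hence lies inside it.\<close>
  then have "D \<subseteq> M"
    using assms(1) supplement_iff[OF D(1)] unfolding minimal_supplement_def by blast
  then show ?thesis
    using assms by (simp add: section_factor_def minimal_supplement_def)
qed

lemma ex_minimal_supplement_chief_factor:
  "\<exists>C D. minimal_supplement F L M C \<and> chief_factor F L C D"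
proof -
  obtain C where C: "minimal_supplement F L M C"
    using ex_minimal_supplement by blast
  then have "ideal C" "\<not> C \<subseteq> M"
    using supplement_iff unfolding minimal_supplement_def by blast+
  moreover have "\<zero>\<^bsub>L\<^esub> \<in> M"
    by (rule sub_zero[OF M_sub])
  ultimately show ?thesis
    using ex_chief_factor[of C] C by blast
qed

text \<open>Here \<open>C\<close> may be any supplement, not just a minimal one. Hence the pair
  behind the chosen \<open>Sec\<close> also computes the ideal index.\<close>

lemma ideal_index_eq:
  assumes "section_factor C D" "reldim F L D C n"
  shows "ideal_index F L M = n"
proof -
  have eq: "vdim F (quotient_alg (L\<lparr>carrier := C'\<rparr>) D') = n"
    if C': "minimal_supplement F L M C'" "chief_factor F L C' D'" for C' D'
  proof -
    have s: "section_factor C' D'"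
      using minimal_supplement_section_factor C' by blast
    note s' = section_factorD[OF s]
    obtain n' where n': "reldim F L D' C' n'"
      using ex_reldim s' ideal_sub by blast
    then have "n = n'"
      using section_factor_reldim_unique assms s by blast
    then show ?thesis
      using vdim_quotient_restrict[OF n'] s' ideal_sub by blast
  qed
  show ?thesis
    unfolding ideal_index_def
    by (rule the_equality) (use eq ex_minimal_supplement_chief_factor in blast)+
qed

text \<open>The choice operator does not reveal which pair it picks, so the later facts are stated
  for an arbitrary \<open>section_factor\<close>. A minimal supplement shows that a pair
  exists.\<close>

lemma obtain_Sec:
  obtains C D where "section_factor C D" "Sec F L M = quotient_alg (L\<lparr>carrier := M \<inter> C\<rparr>) D"
proof -
  have iff: "c_section F L M S \<longleftrightarrow>
      (\<exists>C D. section_factor C D \<and> S = quotient_alg (L\<lparr>carrier := M \<inter> C\<rparr>) D)" for S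
    unfolding c_section_def section_factor_def by blast
  then have "\<exists>S. c_section F L M S"
    using ex_minimal_supplement_chief_factor minimal_supplement_section_factor by blast
  then have "c_section F L M (Sec F L M)"
    unfolding Sec_def by (rule someI_ex)
  then show thesis
    using iff that by blast
qed

lemma c_ideal_iff:
  assumes CD: "section_factor C D"
  shows "c_ideal F L M \<longleftrightarrow> M \<inter> C = D"
proof
  note CDs = section_factorD[OF CD]
  assume "c_ideal F L M"
  then obtain B where B: "ideal B" "carrier L = M <+>\<^bsub>L\<^esub> B" "M \<inter> B \<subseteq> K"
    unfolding c_ideal_def by blast
  then have "\<not> B \<subseteq> M"
    using supplement_iff by blast
  have "ideal (K <+>\<^bsub>L\<^esub> B)" "\<not> K <+>\<^bsub>L\<^esub> B \<subseteq> M"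
    using ideal_set_add[OF K_ideal] subset_core_add(2)[OF B(1)] B(1) \<open>\<not> B \<subseteq> M\<close> by blast+
  \<comment> \<open>In the first alternative the modular law puts \<open>M \<inter> C\<close> into
    \<open>K \<inter> C = D\<close>.\<close>
  then have "C \<subseteq> K <+>\<^bsub>L\<^esub> B \<or> M \<inter> C = D"
    using section_factor_dichotomy[OF CD] subset_core_add(1)[OF B(1)] by blast
  then show "M \<inter> C = D"
    using core_modular[OF B(1,3)] section_factor_core[OF CD] CDs by blast
next
  note CDs = section_factorD[OF CD]
  assume "M \<inter> C = D"
  then have "M \<inter> C \<subseteq> K"
    using K_greatest CDs by blast
  \<comment> \<open>\<open>C\<close> itself is the ideal witnessing that \<open>M\<close> is a
    c-ideal.\<close>
  then show "c_ideal F L M"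
    using CD CDs(1) maximal unfolding c_ideal_def section_factor_def maximal_lie_subalgebra_def by blast
qed

lemma carrier_Sec_trivial_iff:
  assumes CD: "section_factor C D" and S: "S = quotient_alg (L\<lparr>carrier := M \<inter> C\<rparr>) D"
  shows "carrier S = {\<zero>\<^bsub>S\<^esub>} \<longleftrightarrow> M \<inter> C = D"
proof -
  note CDs = section_factorD[OF CD]
  \<comment> \<open>The set of cosets is nonempty, so it is the singleton of \<open>D\<close>
    exactly when every coset in it equals \<open>D\<close>.\<close>
  have "\<zero>\<^bsub>L\<^esub> \<in> M \<inter> C"
    using sub_zero M_sub ideal_sub CDs(1) by blast
  then have "carrier S = {\<zero>\<^bsub>S\<^esub>} \<longleftrightarrow> (\<forall>x\<in>M \<inter> C. D +>\<^bsub>L\<^esub> x = D)"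
    unfolding S quotient_carrier_restrict quotient_zero_restrict by blast
  also have "\<dots> \<longleftrightarrow> M \<inter> C \<subseteq> D"
    using coset_eq_self_iff[OF ideal_sub[OF CDs(2)]] sub_mem_carrier[OF M_sub] by blast
  also have "\<dots> \<longleftrightarrow> M \<inter> C = D"
    using CDs(3,4) by blast
  finally show ?thesis .
qed

end

theorem lemma1p2:
  fixes F :: "('a, 'c) ring_scheme" and L :: "('a, 'b, 'd) module_scheme" and M :: "'b set"
  assumes "lie_algebra F L"
    and "finite_dimensional F L"
    and "maximal_lie_subalgebra F L M"
  shows "(c_ideal F L M \<longleftrightarrow> carrier (Sec F L M) = {\<zero>\<^bsub>Sec F L M\<^esub>}) \<and>
    int (c_index F L M) = int (ideal_index F L M) - int (vdim F (quotient_alg L M))"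
proof -
  interpret lie_algebra_maximal F L M
    by (intro lie_algebra_maximal.intro lie_algebra_maximal_axioms.intro assms)
  obtain C D where CD: "section_factor C D" and S: "Sec F L M = quotient_alg (L\<lparr>carrier := M \<inter> C\<rparr>) D"
    by (rule obtain_Sec)
  note CDs = section_factorD[OF CD]
  have D: "sub D" and MC: "sub (M \<inter> C)"
    using CDs ideal_sub sub_Int M_sub by blast+
  \<comment> \<open>\<open>s\<close> will be the c-index and \<open>t\<close> the codimension of
    \<open>M\<close>; the concatenated flag from \<open>D\<close> to \<open>C\<close> measures the
    ideal index.\<close>
  obtain s where s: "reldim F L D (M \<inter> C) s"
    using ex_reldim[OF D MC] CDs by blast
  obtain t where t: "reldim F L (M \<inter> C) C t"
    using ex_reldim[OF MC ideal_sub[OF CDs(1)]] by blast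
  have "c_index F L M = s"
    unfolding c_index_def S by (rule vdim_quotient_restrict[OF s D])
  moreover have "ideal_index F L M = s + t"
    by (rule ideal_index_eq[OF CD reldim_trans[OF t s]])
  moreover have "vdim F (quotient_alg L M) = t"
    by (rule vdim_quotient[OF reldim_supplement[OF CDs(1,5) t] M_sub])
  ultimately show ?thesis
    using c_ideal_iff[OF CD] carrier_Sec_trivial_iff[OF CD S] by simp
qed

end
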